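(* Let $n\ge 2$. (i) There exists a positive constant $\gamma_n$, depending only on $n$, such that for every $0<\zeta<\gamma_n$ there is a constant $C_{n,\zeta}$, depending only on $n$ and $\zeta$, for which $$\int_{\mathbb{R}^n}\Phi_p\left(\zeta\,\frac{|f(x)|}{\|f\|_{Q_\alpha(\mathbb{R}^n)}}\right)dx\le C_{n,\zeta}\left(\frac{\|f\|_{L^p(\mathbb{R}^n)}}{\|f\|_{Q_\alpha(\mathbb{R}^n)}}\right)^p$$ holds for all $1<p<\infty$, all $-\infty<\alpha<1$ and all $f\in L^p(\mathbb{R}^n)\cap Q_\alpha(\mathbb{R}^n)$ with $\|f\|_{Q_\alpha(\mathbb{R}^n)}\neq 0$. (ii) There exist positive constants $\gamma_n$ and $C_n$, depending only on $n$, such that $$|\{x\in\mathbb{R}^n:|f(x)|>t\}|\le C_n\frac{\|f\|_{L^2(\mathbb{R}^n)}^2}{\|f\|_{Q_\alpha(\mathbb{R}^n)}^2}\cdot\frac{1}{\exp\left(\frac{t\gamma_n}{\|f\|_{Q_\alpha(\mathbb{R}^n)}}\right)-1-\frac{t\gamma_n}{\|f\|_{Q_\alpha(\mathbb{R}^n)}}}$$ holds for all $t>0$, all $-\infty<\alpha<1$ and all $f\in L^2(\mathbb{R}^n)\cap Q_\alpha(\mathbb{R}^n)$ with $\|f\|_{Q_\alpha(\mathbb{R}^n)}\neq 0$; and, in particular, $$|\{x\in\mathbb{R}^n:|f(x)|>t\}|\le C_n\frac{\|f\|_{L^2(\mathbb{R}^n)}^2}{\|f\|_{Q_\alpha(\mathbb{R}^n)}^2}\exp\left(-\frac{t\gamma_n}{\|f\|_{Q_\alpha(\mathbb{R}^n)}}\right)$$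 holds for all $-\infty<\alpha<1$, all $f\in L^2(\mathbb{R}^n)\cap Q_\alpha(\mathbb{R}^n)$ with $\|f\|_{Q_\alpha(\mathbb{R}^n)}\neq 0$ and all $t>\|f\|_{Q_\alpha(\mathbb{R}^n)}$.
   Context: For $1<p<\infty$, $\Phi_p$ is the function $$\Phi_p(t)=e^t-\sum_{j<p,\ j\in\mathbb{N}\cup\{0\}}\frac{t^j}{j!},\qquad t\in\mathbb{R}.$$ For $\alpha\in(-\infty,1)$, $Q_\alpha(\mathbb{R}^n)$ is the set of all measurable complex-valued functions $f$ on $\mathbb{R}^n$ with $$\|f\|_{Q_\alpha(\mathbb{R}^n)}=\sup_I\left((l(I))^{2\alpha-n}\int_I\int_I\frac{|f(x)-f(y)|^2}{|x-y|^{n+2\alpha}}\,dx\,dy\right)^{1/2}<\infty,$$ where the supremum is over all cubes $I\subset\mathbb{R}^n$ with edges parallel to the coordinate axes and $l(I)$ is the edge length of $I$. $|E|$ denotes the Lebesgue measure of $E$. *)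

theory Defs
  imports "HOL-Analysis.Analysis"
begin

definition Phi :: "real \<Rightarrow> real \<Rightarrow> real" where
  "Phi p t = exp t - (\<Sum>j\<in>{j::nat. real j < p}. t ^ j / fact j)"

text \<open>Closed axis-parallel cube with lower corner \<open>a\<close> and edge length \<open>l\<close>.\<close>

definition cube :: "real ^ 'n \<Rightarrow> real \<Rightarrow> (real ^ 'n) set" where
  "cube a l = cbox a (\<chi> i. a $ i + l)"

definition ennreal_sqrt :: "ennreal \<Rightarrow> ennreal" where
  "ennreal_sqrt x = (if x = \<infinity> then \<infinity> else ennreal (sqrt (enn2real x)))"

text \<open>The quantity \<open>\<parallel>f\<parallel>\<close> for the space \<open>Q\<^sub>\<alpha>\<close>, with values in \<open>[0, \<infinity>]\<close>. On the diagonal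
  \<open>x = y\<close> the numerator of the integrand vanishes, so the quotient is \<open>0\<close> there for
  every sign of \<open>n + 2\<alpha>\<close>.\<close>

definition Q_enorm :: "real \<Rightarrow> (real ^ 'n \<Rightarrow> complex) \<Rightarrow> ennreal" where
  "Q_enorm \<alpha> f =
    (SUP (a, l) \<in> {(a, l). 0 < l}.
       ennreal_sqrt
         (ennreal (l powr (2 * \<alpha> - real CARD('n))) *
          (\<integral>\<^sup>+y\<in>cube a l. (\<integral>\<^sup>+x\<in>cube a l.
             ennreal ((cmod (f x - f y))\<^sup>2 / norm (x - y) powr (real CARD('n) + 2 * \<alpha>))
           \<partial>lebesgue) \<partial>lebesgue)))"

definition Q_space :: "real \<Rightarrow> (real ^ 'n \<Rightarrow> complex) set" where
  "Q_space \<alpha> = {f \<in> borel_measurable lebesgue. Q_enorm \<alpha> f < \<infinity>}"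

text \<open>This is the norm only on \<open>Q_space\<close>: \<open>enn2real\<close> sends \<open>\<infinity>\<close> to \<open>0\<close>.\<close>

definition Q_norm :: "real \<Rightarrow> (real ^ 'n \<Rightarrow> complex) \<Rightarrow> real" where
  "Q_norm \<alpha> f = enn2real (Q_enorm \<alpha> f)"

text \<open>The space \<open>L\<^sup>p\<close> as a set of functions rather than of classes modulo null sets.\<close>

definition Lp_space :: "real \<Rightarrow> (real ^ 'n \<Rightarrow> complex) set" where
  "Lp_space p =
    {f \<in> borel_measurable lebesgue. integrable lebesgue (\<lambda>x. cmod (f x) powr p)}"

definition Lp_norm :: "real \<Rightarrow> (real ^ 'n \<Rightarrow> complex) \<Rightarrow> real" where
  "Lp_norm p f = (LINT x|lebesgue. cmod (f x) powr p) powr (1 / p)"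

end

theory Submission
  imports Defs
begin

text \<open>
  For \<open>x\<close> and \<open>z\<close> in small subcubes at opposite corners of a cube of edge \<open>l\<close> one has
  \<open>l \<le> |x - z| \<le> n l\<close> because \<open>n \<ge> 2\<close>, so the kernel is bounded below there uniformly in
  \<open>\<alpha> < 1\<close>. Fixing a good \<open>z\<close> shows that on every dyadic cell \<open>f\<close> deviates from a constant by
  more than a multiple of its norm only on a small proportion of the cell, a condition
  of John--Stroemberg type that bounds the oscillation.

  The John--Nirenberg argument is run on level sets instead of averages: cover
  \<open>E = {|f - w| > s}\<close> by the maximal dyadic cells in which \<open>E\<close> has density above
  \<open>\<theta> = 2^-(n+1)\<close>. Their total measure is at most \<open>|E| / \<theta>\<close>, and on each of them the constant
  of the cell is close to \<open>w\<close>, so the tail estimate for cells passes to \<open>E\<close>. Iterating on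
  cells gives exponential decay; applying the step once more to \<open>{|f| > 1}\<close> on the whole
  space (after normalisation) bounds the tails of \<open>f\<close> by \<open>|{|f| > 1}|\<close>, which is at most the integral of
  \<open>|f|^p\<close> with a constant independent of \<open>p\<close>. Where \<open>|f| \<le> 1\<close>, the function
  \<open>Phi p\<close> is controlled by the power \<open>p\<close> directly.
\<close>

section \<open>Dyadic cells: nesting, countability and measure\<close>

text \<open>Half-open, so that the cells of one generation partition the space; larger
  \<open>k\<close> means larger cells. Since a cell is named by any of its points, the ancestors of
  \<open>dyadic_cell k x\<close> are the \<open>dyadic_cell j x\<close> with
  \<open>j > k\<close>.\<close>

definition dyadic_cell :: "int \<Rightarrow> real ^ 'n \<Rightarrow> (real ^ 'n) set" where
  "dyadic_cell k x = {y. \<forall>i. \<lfloor>y $ i / 2 powi k\<rfloor> = \<lfloor>x $ i / 2 powi k\<rfloor>}"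

lemma self_in_dyadic_cell [simp]: "x \<in> dyadic_cell k x"
  by (simp add: dyadic_cell_def)

lemma dyadic_cell_eq: "y \<in> dyadic_cell k x \<Longrightarrow> dyadic_cell k y = dyadic_cell k x"
  by (simp add: dyadic_cell_def)

text \<open>The floors at scale \<open>k\<close> are the integer quotients by \<open>2 ^ m\<close>
  of the floors at scale \<open>j\<close>, so floors that agree at the finer scale agree at the
  coarser one.\<close>

lemma dyadic_cell_mono:
  assumes "j \<le> k"
  shows "dyadic_cell j x \<subseteq> dyadic_cell k x"
proof -
  define m where "m = nat (k - j)"
  have k: "k = j + int m" using assms by (simp add: m_def)
  have "\<lfloor>u / 2 powi k\<rfloor> = \<lfloor>u / 2 powi j\<rfloor> div 2 ^ m" for u :: real
    using floor_divide_real_eq_div[of "2 ^ m" "u / 2 powi j"] by (simp add: k power_int_add)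
  then show ?thesis by (auto simp: dyadic_cell_def)
qed

text \<open>A cell is determined by \<open>k\<close> and an integer vector of floors, and such pairs
  are countable because the index type is finite.\<close>

lemma countable_dyadic_cells: "countable (range (\<lambda>(k, x :: real ^ 'n). dyadic_cell k x))"
proof -
  have "range (\<lambda>(k, x :: real ^ 'n). dyadic_cell k x)
      \<subseteq> range (\<lambda>(k, v :: 'n \<Rightarrow> int). {y :: real ^ 'n. \<forall>i. \<lfloor>y $ i / 2 powi k\<rfloor> = v i})"
    by (force simp: dyadic_cell_def)
  then show ?thesis by (rule countable_subset) simp
qed

text \<open>A half-open cell is neither an open nor a closed cube. The inner box bounds its measure
  from below; the outer cube bounds it from above and carries estimates on cubes over to
  cells.\<close>

lemma dyadic_cell_cube:
  fixes x :: "real ^ 'n"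
  obtains a where "dyadic_cell k x \<subseteq> cube a (2 powi k)"
    "box a (\<chi> i. a $ i + 2 powi k) \<subseteq> dyadic_cell k x"
proof -
  define a :: "real ^ 'n" where "a = (\<chi> i. 2 powi k * of_int \<lfloor>x $ i / 2 powi k\<rfloor>)"
  have pos: "(0::real) < 2 powi k" by simp
  have "(\<lfloor>y / 2 powi k\<rfloor> = m) \<longleftrightarrow> 2 powi k * of_int m \<le> y \<and> y < 2 powi k * of_int m + 2 powi k"
    for y :: real and m :: int
    using pos by (simp add: floor_eq_iff field_simps)
  then have "dyadic_cell k x = {y. \<forall>i. a $ i \<le> y $ i \<and> y $ i < a $ i + 2 powi k}"
    by (auto simp: dyadic_cell_def a_def)
  then show ?thesis
    by (intro that[of a]) (auto simp: cube_def mem_box_cart less_imp_le)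
qed

lemma emeasure_cube:
  fixes a :: "real ^ 'n"
  assumes "0 \<le> l"
  shows "emeasure lebesgue (cube a l) = ennreal (l ^ CARD('n))"
proof -
  have "cbox a (\<chi> i. a $ i + l) \<noteq> {}"
    using assms by (simp add: interval_ne_empty_cart)
  then have "measure lborel (cbox a (\<chi> i. a $ i + l)) = l ^ CARD('n)"
    by (simp add: content_cbox_cart)
  then show ?thesis
    unfolding cube_def
    using emeasure_eq_ennreal_measure[of lborel "cbox a (\<chi> i. a $ i + l)"] emeasure_lborel_cbox_finite[of a "\<chi> i. a $ i + l"]
    by (simp add: less_top)
qed

lemma emeasure_cube_interior:
  fixes a :: "real ^ 'n"
  assumes "0 \<le> l"
  shows "emeasure lebesgue (box a (\<chi> i. a $ i + l)) = ennreal (l ^ CARD('n))"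
proof -
  have "emeasure lborel (box a (\<chi> i. a $ i + l)) = emeasure lborel (cube a l)"
    unfolding cube_def emeasure_lborel_box_eq emeasure_lborel_cbox_eq ..
  then show ?thesis using emeasure_cube[OF assms, of a] by (simp add: cube_def)
qed

lemma sets_dyadic_cell [measurable]: "dyadic_cell k x \<in> sets lebesgue"
proof -
  have "dyadic_cell k x \<in> sets borel" unfolding dyadic_cell_def by measurable
  then show ?thesis by simp
qed

lemma emeasure_dyadic_cell:
  fixes x :: "real ^ 'n"
  shows "emeasure lebesgue (dyadic_cell k x) = ennreal ((2 powi k) ^ CARD('n))"
proof (rule antisym)
  obtain a where a: "dyadic_cell k x \<subseteq> cube a (2 powi k)"
    "box a (\<chi> i. a $ i + 2 powi k) \<subseteq> dyadic_cell k x"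
    by (rule dyadic_cell_cube)
  show "emeasure lebesgue (dyadic_cell k x) \<le> ennreal ((2 powi k) ^ CARD('n))"
    using emeasure_mono[OF a(1), of lebesgue] emeasure_cube[of "2 powi k" a]
    by (simp add: cube_def)
  show "ennreal ((2 powi k) ^ CARD('n)) \<le> emeasure lebesgue (dyadic_cell k x)"
    using emeasure_mono[OF a(2), of lebesgue] emeasure_cube_interior[of "2 powi k" a] by simp
qed

section \<open>Maximal cells and summation over disjoint families\<close>

text \<open>At each point the generations with \<open>P\<close> are bounded above, so there is a
  largest cell with \<open>P\<close>. If two chosen cells meet and one is of lower generation, the
  larger one is an ancestor of it with \<open>P\<close>, against maximality.\<close>

lemma maximal_dyadic_cells:
  fixes S :: "(real ^ 'n) set"
  assumes ex: "\<And>x. x \<in> S \<Longrightarrow> \<exists>k. P (dyadic_cell k x)"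
    and bounded: "\<And>x. x \<in> S \<Longrightarrow> \<exists>b. \<forall>k\<ge>b. \<not> P (dyadic_cell k x)"
  obtains C where "countable C" "disjoint C" "S \<subseteq> \<Union>C"
    "\<And>I. I \<in> C \<Longrightarrow> \<exists>k x. x \<in> S \<and> I = dyadic_cell k x \<and> P I \<and> (\<forall>j>k. \<not> P (dyadic_cell j x))"
proof -
  have "\<exists>k. P (dyadic_cell k x) \<and> (\<forall>j>k. \<not> P (dyadic_cell j x))" if "x \<in> S" for x
  proof -
    obtain k0 b where k0: "P (dyadic_cell k0 x)" and b: "\<And>k. k \<ge> b \<Longrightarrow> \<not> P (dyadic_cell k x)"
      using ex bounded \<open>x \<in> S\<close> by metis
    \<comment> \<open>\<open>P\<close> may hold for arbitrarily negative \<open>k\<close>; cutting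
      off below \<open>k0\<close> leaves a finite set, so that \<open>Max\<close> is
      meaningful.\<close>
    let ?K = "{k. P (dyadic_cell k x) \<and> k0 \<le> k}"
    have fin: "finite ?K"
      by (rule finite_subset[of _ "{k0..b}"]) (use b in \<open>auto intro: ccontr simp: not_le\<close>)
    have "k0 \<in> ?K" using k0 by simp
    then have "Max ?K \<in> ?K" using fin by (metis Max_in empty_iff)
    moreover have "\<not> P (dyadic_cell j x)" if "j > Max ?K" for j
      using that Max_ge[OF fin, of j] Max_ge[OF fin \<open>k0 \<in> ?K\<close>] by force
    ultimately show ?thesis by blast
  qed
  then obtain K where K: "\<And>x. x \<in> S \<Longrightarrow> P (dyadic_cell (K x) x)"
    "\<And>x j. x \<in> S \<Longrightarrow> j > K x \<Longrightarrow> \<not> P (dyadic_cell j x)"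
    by metis
  define C where "C = (\<lambda>x. dyadic_cell (K x) x) ` S"
  show ?thesis
  proof (rule that[of C])
    show "countable C"
      by (rule countable_subset[OF _ countable_dyadic_cells]) (auto simp: C_def)
    have sub: "K x \<ge> K y" if "x \<in> S" "y \<in> S" "z \<in> dyadic_cell (K x) x" "z \<in> dyadic_cell (K y) y" for x y z
    proof (rule ccontr)
      assume "\<not> K x \<ge> K y"
      then have "z \<in> dyadic_cell (K y) x"
        using that(3) dyadic_cell_mono[of "K x" "K y" x] by auto
      then have "dyadic_cell (K y) x = dyadic_cell (K y) y"
        using that(4) dyadic_cell_eq by metis
      then show False
        using K(1)[OF that(2)] K(2)[OF that(1), of "K y"] \<open>\<not> K x \<ge> K y\<close> by simp
    qed
    show "disjoint C"
    proof (rule disjointI)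
      fix a b assume "a \<in> C" "b \<in> C" "a \<noteq> b"
      then obtain x y where xy: "x \<in> S" "y \<in> S" "a = dyadic_cell (K x) x" "b = dyadic_cell (K y) y"
        by (auto simp: C_def)
      show "a \<inter> b = {}"
      proof (rule ccontr)
        assume "a \<inter> b \<noteq> {}"
        then obtain z where "z \<in> a" "z \<in> b" by auto
        then have "K x = K y" using xy sub by (intro antisym) blast+
        then show False
          using \<open>z \<in> a\<close> \<open>z \<in> b\<close> xy \<open>a \<noteq> b\<close> dyadic_cell_eq by metis
      qed
    qed
    show "S \<subseteq> \<Union>C" by (auto simp: C_def)
    show "\<exists>k x. x \<in> S \<and> I = dyadic_cell k x \<and> P I \<and> (\<forall>j>k. \<not> P (dyadic_cell j x))" if "I \<in> C" for I
      using that K unfolding C_def by blast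
  qed
qed

text \<open>\<open>lebesgue\<close> is \<open>completion lborel\<close>; this rule would replace
  Lebesgue measures by \<open>lborel\<close> measures of main parts and break the uniform form of
  the estimates.\<close>

declare emeasure_completion [simp del]

text \<open>The local inequalities add up over the disjoint pieces. The cover has to exhaust
  \<open>Z\<close> up to a null set; whatever \<open>W\<close> has outside it only enlarges the
  right-hand side.\<close>

lemma emeasure_le_by_disjoint_cover:
  assumes C: "countable C" "disjoint C" "C \<subseteq> sets M"
    and Z: "Z \<in> sets M" and W: "W \<in> sets M"
    and cover: "Z - \<Union>C \<in> null_sets M"
    and le: "\<And>I. I \<in> C \<Longrightarrow> emeasure M (Z \<inter> I) \<le> c * emeasure M (W \<inter> I)"
  shows "emeasure M Z \<le> c * emeasure M W"
proof -
  have disj: "disjoint_family_on (\<lambda>I. A \<inter> I) C" for A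
    using C(2) by (auto simp: disjoint_family_on_def disjoint_def)
  have meas: "\<Union>C \<in> sets M" using C by (auto intro: sets.countable_Union)
  have UN: "emeasure M (A \<inter> \<Union>C) = (\<integral>\<^sup>+I. emeasure M (A \<inter> I) \<partial>count_space C)"
    if "A \<in> sets M" for A
  proof -
    have "A \<inter> \<Union>C = (\<Union>I\<in>C. A \<inter> I)" by auto
    then show ?thesis
      using emeasure_UN_countable[of C "\<lambda>I. A \<inter> I" M] that C disj by auto
  qed
  have "emeasure M Z \<le> emeasure M ((Z \<inter> \<Union>C) \<union> (Z - \<Union>C))"
    by (intro emeasure_mono) (use Z meas in auto)
  also have "\<dots> = emeasure M (Z \<inter> \<Union>C)"
    using cover Z meas by (intro emeasure_Un_null_set) auto
  also have "\<dots> \<le> (\<integral>\<^sup>+I. c * emeasure M (W \<inter> I) \<partial>count_space C)"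
    unfolding UN[OF Z] using le by (intro nn_integral_mono) auto
  also have "\<dots> = c * emeasure M (W \<inter> \<Union>C)"
    unfolding UN[OF W] by (subst nn_integral_cmult) auto
  also have "\<dots> \<le> c * emeasure M W"
    using W by (intro mult_left_mono emeasure_mono) auto
  finally show ?thesis .
qed

section \<open>Dyadic density and stopping cells\<close>

lemma dyadic_cell_subset_open:
  fixes x :: "real ^ 'n"
  assumes "open U" "x \<in> U"
  obtains k where "dyadic_cell k x \<subseteq> U"
proof -
  obtain e where e: "e > 0" "ball x e \<subseteq> U" using assms by (meson open_contains_ball)
  let ?n = "real CARD('n)"
  have n: "?n > 0" by simp
  \<comment> \<open>Coordinates of two points of a cell differ by at most the edge, so by the l1
    norm the diameter is at most \<open>?n\<close> times the edge.\<close>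
  then obtain m where m: "(1 / 2) ^ m < e / ?n"
    using real_arch_pow_inv[of "e / ?n" "1/2"] e by auto
  have "dist x y < e" if "y \<in> dyadic_cell (- int m) x" for y
  proof -
    have "\<bar>x $ i - y $ i\<bar> \<le> (1 / 2) ^ m" for i
    proof -
      obtain a :: "real ^ 'n" where a: "dyadic_cell (- int m) x \<subseteq> cube a (2 powi (- int m))"
        by (rule dyadic_cell_cube)
      then have "x \<in> cube a (2 powi (- int m))" "y \<in> cube a (2 powi (- int m))"
        using that by auto
      then have "x $ i \<in> {a $ i..a $ i + 2 powi (- int m)}" "y $ i \<in> {a $ i..a $ i + 2 powi (- int m)}"
        by (auto simp: cube_def mem_box_cart)
      then show ?thesis by (auto simp: power_int_minus power_one_over inverse_eq_divide)
    qed
    then have "(\<Sum>i\<in>UNIV. \<bar>(x - y) $ i\<bar>) \<le> (\<Sum>i\<in>(UNIV::'n set). (1 / 2) ^ m)"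
      by (intro sum_mono) auto
    then have "norm (x - y) \<le> ?n * (1 / 2) ^ m"
      using norm_le_l1_cart[of "x - y"] by simp
    also have "\<dots> < e" using m n by (simp add: field_simps)
    finally show ?thesis by (simp add: dist_norm)
  qed
  then have "dyadic_cell (- int m) x \<subseteq> U" using e by auto
  then show ?thesis by (rule that)
qed

text \<open>Provides the upper bound on generations that the selection of maximal cells
  requires.\<close>

lemma large_dyadic_cell:
  fixes x :: "real ^ 'n"
  obtains b where "\<And>k. k \<ge> b \<Longrightarrow> ennreal m < emeasure lebesgue (dyadic_cell k x)"
proof -
  obtain b where b: "m < 2 ^ b" using real_arch_pow[of 2 m] by auto
  show ?thesis
  proof (rule that)
    fix k assume k: "k \<ge> int b"
    have "m < 2 powi (int b)" using b by simp
    also have "\<dots> \<le> 2 powi k" using k by (intro power_int_increasing) auto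
    also have "\<dots> \<le> (2 powi k) ^ CARD('n)"
      using k by (intro self_le_power one_le_power_int) auto
    finally show "ennreal m < emeasure lebesgue (dyadic_cell k x)"
      by (simp add: emeasure_dyadic_cell ennreal_lessI)
  qed
qed

text \<open>A weak substitute for the Lebesgue density theorem: an open set slightly larger than the
  exceptional set is a disjoint union of cells, in each of which the set has density at most \<open>\<theta>\<close>.\<close>

lemma dyadic_density:
  fixes E :: "(real ^ 'n) set"
  assumes E: "E \<in> sets lebesgue" "emeasure lebesgue E < \<infinity>" and \<theta>: "0 < \<theta>" "\<theta> < 1"
  shows "{x \<in> E. \<forall>k. \<not> ennreal \<theta> * emeasure lebesgue (dyadic_cell k x)
      < emeasure lebesgue (E \<inter> dyadic_cell k x)} \<in> null_sets lebesgue" (is "?N \<in> _")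
proof -
  let ?\<mu> = "emeasure (lebesgue :: (real ^ 'n) measure)"
  let ?D = "{I \<in> range (\<lambda>(k, x :: real ^ 'n). dyadic_cell k x). ennreal \<theta> * ?\<mu> I < ?\<mu> (E \<inter> I)}"
  \<comment> \<open>Gives measurability of \<open>?N\<close>: the dense cells form a countable
    family of measurable sets.\<close>
  have "?N = E - \<Union>?D"
  proof (intro equalityI subsetI)
    fix x assume x: "x \<in> ?N"
    have "I \<notin> ?D" if "x \<in> I" for I
    proof
      assume "I \<in> ?D"
      then obtain k y where I: "I = dyadic_cell k y" "ennreal \<theta> * ?\<mu> I < ?\<mu> (E \<inter> I)" by auto
      then have "I = dyadic_cell k x" using dyadic_cell_eq \<open>x \<in> I\<close> by metis
      then show False using x I(2) by blast
    qed
    then show "x \<in> E - \<Union>?D" using x by blast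
  next
    fix x assume "x \<in> E - \<Union>?D"
    then show "x \<in> ?N" using self_in_dyadic_cell[of x] by blast
  qed
  moreover have "\<Union>?D \<in> sets lebesgue"
    using countable_dyadic_cells by (intro sets.countable_Union) (auto intro: countable_subset)
  ultimately have N: "?N \<in> sets lebesgue" using E by auto
  have "?\<mu> ?N \<le> ?\<mu> E" using E by (intro emeasure_mono) auto
  with E have Nfin: "?\<mu> ?N < \<infinity>" by (simp add: le_less_trans)
  define m where "m = measure lebesgue ?N"
  have m: "?\<mu> ?N = ennreal m" using Nfin by (simp add: m_def emeasure_eq_ennreal_measure)
  have "m \<le> 0"
  proof (rule ccontr)
    assume "\<not> m \<le> 0"
    then have pos: "m * (1 - \<theta>) / \<theta> > 0" using \<theta> by simp
    \<comment> \<open>The excess is chosen so that \<open>U\<close> has measure less than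
      \<open>m / \<theta>\<close>; density at most \<open>\<theta>\<close> in the cells filling
      \<open>U\<close> then forces the measure of \<open>?N\<close> below \<open>m\<close>, a
      contradiction.\<close>
    obtain U where U: "open U" "?N \<subseteq> U" "U - ?N \<in> lmeasurable" "?\<mu> (U - ?N) < ennreal (m * (1 - \<theta>) / \<theta>)"
      using sets_lebesgue_outer_open[OF N pos] by blast
    have "?\<mu> U = ?\<mu> ?N + ?\<mu> (U - ?N)"
      using U N by (subst plus_emeasure) (auto intro: fmeasurableD simp: Un_absorb1)
    also have "\<dots> < ennreal m + ennreal (m * (1 - \<theta>) / \<theta>)"
      unfolding m using U(4) by (simp add: ennreal_add_left_cancel_less)
    also have "\<dots> = ennreal (m / \<theta>)"
      using \<theta> pos \<open>\<not> m \<le> 0\<close> by (subst ennreal_plus[symmetric]) (auto simp: field_simps)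
    finally have Um: "?\<mu> U < ennreal (m / \<theta>)" .
    obtain C where C: "countable C" "disjoint C" "?N \<subseteq> \<Union>C"
      and IC: "\<And>I. I \<in> C \<Longrightarrow> \<exists>k x. x \<in> ?N \<and> I = dyadic_cell k x \<and> I \<subseteq> U \<and> (\<forall>j>k. \<not> dyadic_cell j x \<subseteq> U)"
    proof (rule maximal_dyadic_cells[of ?N "\<lambda>I. I \<subseteq> U"])
      show "\<exists>k. dyadic_cell k x \<subseteq> U" if "x \<in> ?N" for x
        using dyadic_cell_subset_open[OF U(1), of x] that U(2) by blast
      show "\<exists>b. \<forall>k\<ge>b. \<not> dyadic_cell k x \<subseteq> U" if "x \<in> ?N" for x
      proof -
        obtain b where b: "\<And>k. k \<ge> b \<Longrightarrow> ennreal (m / \<theta>) < ?\<mu> (dyadic_cell k x)"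
          by (rule large_dyadic_cell[where x = x and m = "m / \<theta>"]) auto
        have "\<not> dyadic_cell k x \<subseteq> U" if "k \<ge> b" for k
        proof
          assume "dyadic_cell k x \<subseteq> U"
          then have "?\<mu> (dyadic_cell k x) \<le> ?\<mu> U" using U(1) by (intro emeasure_mono) auto
          then show False using b[OF that] Um by (metis leD le_less_trans order.strict_trans)
        qed
        then show ?thesis by blast
      qed
    qed blast
    have "?\<mu> ?N \<le> ennreal \<theta> * ?\<mu> U"
    proof (rule emeasure_le_by_disjoint_cover[OF C(1,2)])
      show "C \<subseteq> sets lebesgue" using IC sets_dyadic_cell by blast
      show "?N - \<Union>C \<in> null_sets lebesgue" using C(3) by (simp add: Diff_eq_empty_iff[THEN iffD2])
      show "?\<mu> (?N \<inter> I) \<le> ennreal \<theta> * ?\<mu> (U \<inter> I)" if "I \<in> C" for I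
      proof -
        obtain k x where I: "x \<in> ?N" "I = dyadic_cell k x" "I \<subseteq> U" using IC[OF \<open>I \<in> C\<close>] by blast
        have "?\<mu> (?N \<inter> I) \<le> ?\<mu> (E \<inter> I)" using E I by (intro emeasure_mono) auto
        also have "\<dots> \<le> ennreal \<theta> * ?\<mu> I" using I by (auto simp: not_less)
        finally show ?thesis using I(3) by (simp add: Int_absorb1)
      qed
    qed (use N U in auto)
    also have "\<dots> < ennreal \<theta> * ennreal (m / \<theta>)"
      using Um \<theta> by (intro ennreal_mult_strict_left_mono) auto
    also have "\<dots> = ennreal m" using \<theta> \<open>\<not> m \<le> 0\<close> by (simp add: ennreal_mult[symmetric])
    finally show False using m by simp
  qed
  then have "?\<mu> ?N = 0" using m by (simp add: ennreal_neg)
  then show ?thesis using N by (simp add: null_sets_def)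
qed

text \<open>The Calderon-Zygmund cells of the indicator function of \<open>E\<close> at height
  \<open>\<theta>\<close>. Almost every point of \<open>E\<close> lies in a dense cell, and finite
  measure of \<open>E\<close> prevents large cells from being dense, so maximal dense cells
  exist.\<close>

lemma stopping_dyadic_cells:
  fixes E :: "(real ^ 'n) set"
  assumes E: "E \<in> sets lebesgue" "emeasure lebesgue E < \<infinity>" and \<theta>: "0 < \<theta>" "\<theta> < 1"
  obtains C where "countable C" "disjoint C" "E - \<Union>C \<in> null_sets lebesgue"
    "\<And>I. I \<in> C \<Longrightarrow> \<exists>k x. x \<in> E \<and> I = dyadic_cell k x \<and>
        ennreal \<theta> * emeasure lebesgue I < emeasure lebesgue (E \<inter> I) \<and>
        (\<forall>j>k. emeasure lebesgue (E \<inter> dyadic_cell j x) \<le> ennreal \<theta> * emeasure lebesgue (dyadic_cell j x))"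
proof -
  let ?\<mu> = "emeasure (lebesgue :: (real ^ 'n) measure)"
  let ?P = "\<lambda>I. ennreal \<theta> * ?\<mu> I < ?\<mu> (E \<inter> I)"
  define N where "N = {x \<in> E. \<forall>k. \<not> ?P (dyadic_cell k x)}"
  have N: "N \<in> null_sets lebesgue" unfolding N_def by (rule dyadic_density[OF E \<theta>])
  obtain C where C: "countable C" "disjoint C" "E - N \<subseteq> \<Union>C"
    and IC: "\<And>I. I \<in> C \<Longrightarrow> \<exists>k x. x \<in> E - N \<and> I = dyadic_cell k x \<and> ?P I \<and> (\<forall>j>k. \<not> ?P (dyadic_cell j x))"
  proof (rule maximal_dyadic_cells[of "E - N" ?P])
    show "\<exists>k. ?P (dyadic_cell k x)" if "x \<in> E - N" for x
      using that by (auto simp: N_def)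
    show "\<exists>b. \<forall>k\<ge>b. \<not> ?P (dyadic_cell k x)" if "x \<in> E - N" for x
    proof -
      define m where "m = measure lebesgue E"
      have m: "?\<mu> E = ennreal m" using E by (simp add: m_def emeasure_eq_ennreal_measure)
      obtain b where b: "\<And>k. k \<ge> b \<Longrightarrow> ennreal (m / \<theta>) < ?\<mu> (dyadic_cell k x)"
        by (rule large_dyadic_cell[where x = x and m = "m / \<theta>"]) auto
      have "\<not> ?P (dyadic_cell k x)" if "k \<ge> b" for k
      proof -
        have "?\<mu> (E \<inter> dyadic_cell k x) \<le> ennreal m"
          using m E by (metis emeasure_mono Int_lower1)
        also have "\<dots> = ennreal \<theta> * ennreal (m / \<theta>)"
          using \<theta> by (simp add: m_def ennreal_mult[symmetric])
        also have "\<dots> \<le> ennreal \<theta> * ?\<mu> (dyadic_cell k x)"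
          using b[OF that] by (intro mult_left_mono) auto
        finally show ?thesis by simp
      qed
      then show ?thesis by blast
    qed
  qed blast
  have sub: "E - \<Union>C \<subseteq> N" using C(3) by auto
  have "C \<subseteq> sets lebesgue" using IC sets_dyadic_cell by blast
  then have "E - \<Union>C \<in> sets lebesgue" using C(1) E by (auto intro!: sets.countable_Union)
  then have "E - \<Union>C \<in> null_sets lebesgue" using N sub by (meson null_sets_subset)
  then show ?thesis
    using C(1,2) IC by (intro that[of C]) (simp_all add: not_less, blast)
qed

section \<open>John-Nirenberg decay of level sets\<close>

lemma emeasure_dyadic_cell_Suc:
  fixes x :: "real ^ 'n"
  shows "emeasure lebesgue (dyadic_cell (k + 1) x) = ennreal (2 ^ CARD('n)) * emeasure lebesgue (dyadic_cell k x)"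
  unfolding emeasure_dyadic_cell
  by (simp add: power_int_add power_mult_distrib ennreal_mult[symmetric] mult.commute)

text \<open>In a stopping cell \<open>I\<close> the set \<open>E\<close> fills at most half of \<open>I\<close>, by comparison with its parent,
  so some point of \<open>I\<close> has both \<open>f\<close> within \<open>s\<close> of \<open>w\<close> and \<open>f\<close> within \<open>r\<close> of \<open>c I\<close>.\<close>

lemma distribution_step:
  fixes f :: "real ^ 'n \<Rightarrow> 'b :: {second_countable_topology, real_normed_vector}"
    and c :: "(real ^ 'n) set \<Rightarrow> 'b"
  defines "\<theta> \<equiv> 1 / 2 ^ (CARD('n) + 1)"
  defines "E \<equiv> \<lambda>S w s. {y \<in> S. norm (f y - w) > s}"
  assumes f: "f \<in> borel_measurable lebesgue"
    and osc: "\<And>k x. emeasure lebesgue (E (dyadic_cell k x) (c (dyadic_cell k x)) r)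
                  \<le> ennreal (\<theta> / 2) * emeasure lebesgue (dyadic_cell k x)"
    and tail: "\<And>k x. emeasure lebesgue (E (dyadic_cell k x) (c (dyadic_cell k x)) t)
                  \<le> ennreal \<phi> * emeasure lebesgue (dyadic_cell k x)"
    and "0 \<le> r" "0 \<le> t" "0 \<le> \<phi>"
    and fin: "emeasure lebesgue (E S w s) < \<infinity>"
    and S: "S = UNIV \<or> (\<exists>k x. S = dyadic_cell k x \<and>
                  emeasure lebesgue (E S w s) \<le> ennreal \<theta> * emeasure lebesgue S)"
  shows "emeasure lebesgue (E S w (s + r + t)) \<le> ennreal (\<phi> / \<theta>) * emeasure lebesgue (E S w s)"
proof -
  let ?\<mu> = "emeasure (lebesgue :: (real ^ 'n) measure)"
  have Eset: "E T v q \<in> sets lebesgue" if "T \<in> sets lebesgue" for T v q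
  proof -
    have "{y \<in> space lebesgue. norm (f y - v) > q} \<in> sets lebesgue" using f by measurable
    then have "T \<inter> {y. norm (f y - v) > q} \<in> sets lebesgue" using that by auto
    then show ?thesis by (simp add: E_def Int_def)
  qed
  \<comment> \<open>The last equation explains the choice of \<open>\<theta>\<close>: a parent has
    \<open>2 ^ CARD('n)\<close> times the measure of its child, so density \<open>\<theta>\<close>
    in the parent leaves at most half of the child.\<close>
  have \<theta>: "0 < \<theta>" "\<theta> < 1" "2 ^ CARD('n) * \<theta> = 1 / 2"
  proof -
    have "(1::real) < 2 ^ (CARD('n) + 1)" by (rule one_less_power) auto
    then show "\<theta> < 1" by (simp add: \<theta>_def)
  qed (auto simp: \<theta>_def)
  have Sset: "S \<in> sets lebesgue" using S by auto
  obtain C where C: "countable C" "disjoint C" "E S w s - \<Union>C \<in> null_sets lebesgue"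
    and IC: "\<And>I. I \<in> C \<Longrightarrow> \<exists>k x. x \<in> E S w s \<and> I = dyadic_cell k x \<and>
        ennreal \<theta> * ?\<mu> I < ?\<mu> (E S w s \<inter> I) \<and>
        (\<forall>j>k. ?\<mu> (E S w s \<inter> dyadic_cell j x) \<le> ennreal \<theta> * ?\<mu> (dyadic_cell j x))"
    by (rule stopping_dyadic_cells[OF Eset[OF Sset] fin \<theta>(1,2)]) blast
  show ?thesis
  proof (rule emeasure_le_by_disjoint_cover[OF C(1,2)])
    show Cset: "C \<subseteq> sets lebesgue" using IC sets_dyadic_cell by blast
    have "E S w (s + r + t) \<subseteq> E S w s" using \<open>0 \<le> r\<close> \<open>0 \<le> t\<close> by (auto simp: E_def)
    then have "E S w (s + r + t) - \<Union>C \<subseteq> E S w s - \<Union>C" by auto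
    moreover have "E S w (s + r + t) - \<Union>C \<in> sets lebesgue"
      using Eset[OF Sset] C(1) Cset by (auto intro!: sets.countable_Union)
    ultimately show "E S w (s + r + t) - \<Union>C \<in> null_sets lebesgue"
      using C(3) by (meson null_sets_subset)
    show "?\<mu> (E S w (s + r + t) \<inter> I) \<le> ennreal (\<phi> / \<theta>) * ?\<mu> (E S w s \<inter> I)" if "I \<in> C" for I
    proof -
      obtain k x where x: "x \<in> E S w s" and I: "I = dyadic_cell k x"
        and dense: "ennreal \<theta> * ?\<mu> I < ?\<mu> (E S w s \<inter> I)"
        and sparse: "\<And>j. j > k \<Longrightarrow> ?\<mu> (E S w s \<inter> dyadic_cell j x) \<le> ennreal \<theta> * ?\<mu> (dyadic_cell j x)"
        using IC[OF \<open>I \<in> C\<close>] by blast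
      \<comment> \<open>If \<open>S\<close> is a cell, then it is nested with \<open>I\<close>. Were
        \<open>S\<close> contained in \<open>I\<close>, the sparse set could not have density above
        \<open>\<theta>\<close> in \<open>I\<close>.\<close>
      have "I \<subseteq> S"
        using S
      proof (elim disjE exE conjE)
        fix k0 x0 assume S0: "S = dyadic_cell k0 x0"
          and le: "?\<mu> (E S w s) \<le> ennreal \<theta> * ?\<mu> S"
        have Sx: "S = dyadic_cell k0 x" using x dyadic_cell_eq S0 by (auto simp: E_def)
        have "k < k0"
        proof (rule ccontr)
          assume "\<not> k < k0"
          then have "S \<subseteq> I" unfolding Sx I by (intro dyadic_cell_mono) auto
          then have "ennreal \<theta> * ?\<mu> S \<le> ennreal \<theta> * ?\<mu> I"
            unfolding I by (intro mult_left_mono emeasure_mono) auto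
          moreover have "?\<mu> (E S w s \<inter> I) \<le> ?\<mu> (E S w s)"
            using Eset[OF Sset] by (intro emeasure_mono) auto
          ultimately show False using le dense by auto
        qed
        then show "I \<subseteq> S" unfolding Sx I by (intro dyadic_cell_mono) auto
      qed simp
      define V where "V = ((2::real) powi k) ^ CARD('n)"
      have V: "?\<mu> I = ennreal V" "0 < V" by (simp_all add: V_def I emeasure_dyadic_cell)
      have "?\<mu> (E S w s \<inter> I) \<le> ?\<mu> (E S w s \<inter> dyadic_cell (k + 1) x)"
        unfolding I using dyadic_cell_mono[of k "k + 1" x] Eset[OF Sset] by (intro emeasure_mono) auto
      also have "\<dots> \<le> ennreal \<theta> * ?\<mu> (dyadic_cell (k + 1) x)" by (rule sparse) simp
      also have "\<dots> = ennreal (V / 2)"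
        unfolding emeasure_dyadic_cell_Suc I[symmetric] V
        using \<theta> V(2) by (simp add: ennreal_mult[symmetric] flip: mult.assoc) (simp add: mult.commute)
      finally have half: "?\<mu> (E S w s \<inter> I) \<le> ennreal (V / 2)" .
      have quarter: "?\<mu> (E I (c I) r) \<le> ennreal (V / 4)"
      proof -
        have "?\<mu> (E I (c I) r) \<le> ennreal (\<theta> / 2) * ennreal V"
          using osc[of k x] V(1) unfolding I by simp
        also have "\<dots> = ennreal (\<theta> / 2 * V)" using \<theta> V by (simp add: ennreal_mult[symmetric])
        also have "\<dots> \<le> ennreal (V / 4)"
        proof (intro ennreal_leI)
          have "(2::real) \<le> 2 ^ CARD('n)" by (rule self_le_power) auto
          then have "\<theta> * 2 \<le> \<theta> * 2 ^ CARD('n)" using \<theta> by (intro mult_left_mono) auto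
          then have "\<theta> / 2 \<le> 1 / 4" using \<theta>(3) by (simp add: mult.commute)
          then show "\<theta> / 2 * V \<le> V / 4" using V mult_right_mono[of "\<theta> / 2" "1 / 4" V] by simp
        qed
        finally show ?thesis .
      qed
      obtain z where z: "z \<in> I" "z \<notin> E S w s" "z \<notin> E I (c I) r"
      proof -
        have "\<not> I \<subseteq> (E S w s \<inter> I) \<union> E I (c I) r"
        proof
          assume "I \<subseteq> (E S w s \<inter> I) \<union> E I (c I) r"
          then have "?\<mu> I \<le> ?\<mu> ((E S w s \<inter> I) \<union> E I (c I) r)"
            using Eset Sset I by (intro emeasure_mono) auto
          also have "\<dots> \<le> ?\<mu> (E S w s \<inter> I) + ?\<mu> (E I (c I) r)"
            using Eset Sset I by (intro emeasure_subadditive) auto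
          also have "\<dots> \<le> ennreal (V / 2) + ennreal (V / 4)" by (intro add_mono half quarter)
          also have "\<dots> < ennreal V" using V by (simp add: ennreal_plus[symmetric] ennreal_lessI del: ennreal_plus)
          finally show False using V by simp
        qed
        then show ?thesis using that by auto
      qed
      have "norm (c I - w) \<le> norm (f z - w) + norm (f z - c I)"
        using norm_triangle_ineq4[of "f z - w" "f z - c I"] by simp
      also have "\<dots> \<le> s + r" using z \<open>I \<subseteq> S\<close> by (auto simp: E_def)
      finally have cw: "norm (c I - w) \<le> s + r" .
      have "E S w (s + r + t) \<inter> I \<subseteq> E I (c I) t"
      proof
        fix y assume y: "y \<in> E S w (s + r + t) \<inter> I"
        have "norm (f y - w) \<le> norm (f y - c I) + norm (c I - w)"
          using norm_triangle_ineq[of "f y - c I" "c I - w"] by simp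
        then show "y \<in> E I (c I) t" using y cw by (auto simp: E_def)
      qed
      then have "?\<mu> (E S w (s + r + t) \<inter> I) \<le> ?\<mu> (E I (c I) t)"
        using Eset I by (intro emeasure_mono) auto
      also have "\<dots> \<le> ennreal \<phi> * ?\<mu> I" unfolding I by (rule tail)
      \<comment> \<open>Density exchanges the measure of \<open>I\<close> for that of the level set
        inside \<open>I\<close>, at the price of a factor \<open>1 / \<theta>\<close>.\<close>
      also have "\<dots> = ennreal (\<phi> / \<theta>) * (ennreal \<theta> * ?\<mu> I)"
        using \<theta> \<open>0 \<le> \<phi>\<close> by (simp add: ennreal_mult[symmetric] flip: mult.assoc)
      also have "\<dots> \<le> ennreal (\<phi> / \<theta>) * ?\<mu> (E S w s \<inter> I)"
        using dense by (intro mult_left_mono) auto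
      finally show ?thesis .
    qed
  qed (use Eset Sset in auto)
qed

text \<open>Induction on \<open>m\<close>, with \<open>distribution_step\<close> applied to the
  exceptional set at level \<open>r\<close>. The step costs a factor \<open>1 / \<theta>\<close>,
  but that set has density at most \<open>\<theta> / 2\<close>; hence each rise of the level by
  \<open>2 * r\<close> gains a factor \<open>1 / 2\<close>.\<close>

lemma dyadic_john_nirenberg:
  fixes f :: "real ^ 'n \<Rightarrow> 'b :: {second_countable_topology, real_normed_vector}"
    and c :: "(real ^ 'n) set \<Rightarrow> 'b"
  defines "\<theta> \<equiv> 1 / 2 ^ (CARD('n) + 1)"
  assumes f: "f \<in> borel_measurable lebesgue"
    and osc: "\<And>k x. emeasure lebesgue {y \<in> dyadic_cell k x. norm (f y - c (dyadic_cell k x)) > r}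
                  \<le> ennreal (\<theta> / 2) * emeasure lebesgue (dyadic_cell k x)"
    and r: "0 \<le> r"
  shows "emeasure lebesgue {y \<in> dyadic_cell k x. norm (f y - c (dyadic_cell k x)) > 2 * r * real m}
           \<le> ennreal (1 / 2 ^ m) * emeasure lebesgue (dyadic_cell k x)"
proof (induction m arbitrary: k x)
  case 0
  have "emeasure lebesgue {y \<in> dyadic_cell k x. norm (f y - c (dyadic_cell k x)) > 2 * r * real 0}
      \<le> emeasure lebesgue (dyadic_cell k x)"
    by (intro emeasure_mono) auto
  then show ?case by (simp)
next
  case (Suc m)
  let ?\<mu> = "emeasure (lebesgue :: (real ^ 'n) measure)"
  let ?I = "dyadic_cell k x"
  let ?E = "{y \<in> ?I. norm (f y - c ?I) > r}"
  have \<theta>: "0 < \<theta>" by (simp add: \<theta>_def)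
  have eq: "r + r + 2 * r * real m = 2 * r * real (Suc m)" by (simp add: algebra_simps)
  have le: "?\<mu> ?E \<le> ennreal \<theta> * ?\<mu> ?I"
    using osc[of k x] \<theta> by (elim order_trans) (intro mult_right_mono ennreal_leI; simp)
  have "?\<mu> ?I < \<infinity>" by (simp add: emeasure_dyadic_cell)
  then have "?\<mu> ?E < \<infinity>"
    by (intro le_less_trans[OF le]) (simp add: ennreal_mult_less_top)
  then have "?\<mu> {y \<in> ?I. norm (f y - c ?I) > r + r + 2 * r * real m}
      \<le> ennreal (1 / 2 ^ m / \<theta>) * ?\<mu> ?E"
    unfolding \<theta>_def using le[unfolded \<theta>_def] r
    by (intro distribution_step[OF f osc[unfolded \<theta>_def] Suc.IH]) auto
  also have "\<dots> \<le> ennreal (1 / 2 ^ m / \<theta>) * (ennreal (\<theta> / 2) * ?\<mu> ?I)"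
    by (intro mult_left_mono osc) auto
  also have "\<dots> = ennreal (1 / 2 ^ Suc m) * ?\<mu> ?I"
    using \<theta> by (simp add: ennreal_mult[symmetric] mult.assoc[symmetric]) (simp add: field_simps)
  finally show ?case by (simp only: eq)
qed

text \<open>One more use of \<open>distribution_step\<close>, on the whole space with centre
  \<open>0\<close>, fed with the decay on cells. The loss \<open>2 ^ (CARD('n) + 1)\<close> is
  \<open>1 / \<theta>\<close>: no smallness of the level set is available globally to absorb
  it.\<close>

lemma global_john_nirenberg:
  fixes f :: "real ^ 'n \<Rightarrow> 'b :: {second_countable_topology, real_normed_vector}"
    and c :: "(real ^ 'n) set \<Rightarrow> 'b"
  assumes f: "f \<in> borel_measurable lebesgue"
    and osc: "\<And>k x. emeasure lebesgue {y \<in> dyadic_cell k x. norm (f y - c (dyadic_cell k x)) > r}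
                  \<le> ennreal (1 / 2 ^ (CARD('n) + 1) / 2) * emeasure lebesgue (dyadic_cell k x)"
    and r: "0 \<le> r"
    and fin: "emeasure lebesgue {y. norm (f y) > s} < \<infinity>"
  shows "emeasure lebesgue {y. norm (f y) > s + r + 2 * r * real m}
           \<le> ennreal (2 ^ (CARD('n) + 1) / 2 ^ m) * emeasure lebesgue {y. norm (f y) > s}"
  using distribution_step[OF f osc dyadic_john_nirenberg[OF f osc r], where S = UNIV and w = 0 and s = s] r fin
  by simp

section \<open>Exponential integrals from geometric tails\<close>

text \<open>Above \<open>b\<close>, split into layers of height \<open>K\<close>: the exponential
  grows by \<open>exp (\<zeta> * K)\<close> per layer while the measure bound halves, so the layers
  sum to a geometric series of ratio \<open>exp (\<zeta> * K) / 2 < 1\<close>. Up to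
  \<open>b\<close> the exponential is at most \<open>exp (\<zeta> * b)\<close>.\<close>

lemma exp_integral_of_geometric_tails:
  fixes u :: "'a \<Rightarrow> real"
  assumes u [measurable]: "u \<in> borel_measurable M"
    and tail: "\<And>m. emeasure M {x \<in> space M. u x > b + K * real m} \<le> ennreal (B / 2 ^ m) * X"
    and "0 < K" "0 < \<zeta>" "0 \<le> B" and small: "exp (\<zeta> * K) < 2"
    and X: "X = emeasure M {x \<in> space M. u x > s}"
  shows "(\<integral>\<^sup>+x. ennreal (exp (\<zeta> * u x)) * indicator {x \<in> space M. u x > s} x \<partial>M)
      \<le> ennreal (exp (\<zeta> * b) + B * exp (\<zeta> * (b + K)) / (1 - exp (\<zeta> * K) / 2)) * X"
proof -
  define L where "L m = exp (\<zeta> * (b + K * (real m + 1)))" for m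
  define T where "T m = {x \<in> space M. u x > b + K * real m}" for m
  have T [measurable]: "T m \<in> sets M" for m unfolding T_def by measurable
  have L: "0 \<le> L m" for m by (simp add: L_def)
  have pt: "ennreal (exp (\<zeta> * u x)) * indicator {x \<in> space M. u x > s} x
      \<le> ennreal (exp (\<zeta> * b)) * indicator {x \<in> space M. u x > s} x
        + (\<Sum>m. ennreal (L m) * indicator (T m) x)" if x: "x \<in> space M" for x
  proof (cases "u x > b")
    case True
    \<comment> \<open>Ceiling minus one rather than floor: the tail sets use a strict inequality, so
      the layers are open below and closed above.\<close>
    define m where "m = nat (\<lceil>(u x - b) / K\<rceil> - 1)"
    have "0 < (u x - b) / K" using True \<open>0 < K\<close> by simp
    then have "1 \<le> \<lceil>(u x - b) / K\<rceil>" by linarith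
    then have m: "real m = of_int \<lceil>(u x - b) / K\<rceil> - 1" by (simp add: m_def)
    then have "real m < (u x - b) / K" "(u x - b) / K \<le> real m + 1" by linarith+
    then have m2: "u x > b + K * real m" "u x \<le> b + K * (real m + 1)"
      using \<open>0 < K\<close> by (simp_all add: field_simps)
    have "ennreal (exp (\<zeta> * u x)) * indicator {x \<in> space M. u x > s} x \<le> ennreal (exp (\<zeta> * u x))"
      by (simp add: indicator_def)
    also have "\<dots> \<le> ennreal (L m) * indicator (T m) x"
      using m2 x \<open>0 < \<zeta>\<close> by (simp add: L_def T_def ennreal_leI)
    also have "\<dots> \<le> (\<Sum>m. ennreal (L m) * indicator (T m) x)"
    proof -
      have "g m \<le> suminf g" for g :: "nat \<Rightarrow> ennreal"
        using sum_le_suminf[of g "{m}"] by (simp add: summableI)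
      then show ?thesis .
    qed
    finally show ?thesis by (simp add: add_increasing)
  next
    case False
    then have "ennreal (exp (\<zeta> * u x)) \<le> ennreal (exp (\<zeta> * b))"
      using \<open>0 < \<zeta>\<close> by (intro ennreal_leI) simp
    then have "ennreal (exp (\<zeta> * u x)) * indicator {x \<in> space M. u x > s} x
        \<le> ennreal (exp (\<zeta> * b)) * indicator {x \<in> space M. u x > s} x"
      by (intro mult_right_mono) auto
    then show ?thesis by (simp add: add_increasing2)
  qed
  let ?q = "exp (\<zeta> * K) / 2"
  have sums: "(\<lambda>m. B * exp (\<zeta> * (b + K)) * ?q ^ m) sums (B * exp (\<zeta> * (b + K)) * (1 / (1 - ?q)))"
    using small by (intro sums_mult geometric_sums) simp
  have term_eq: "L m * B / 2 ^ m = B * exp (\<zeta> * (b + K)) * ?q ^ m" for m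
  proof -
    have "L m = exp (\<zeta> * (b + K)) * exp (\<zeta> * K) ^ m"
      unfolding L_def exp_of_nat_mult[symmetric] exp_add[symmetric] by (simp add: algebra_simps)
    then show ?thesis by (simp add: power_divide)
  qed
  have "(\<integral>\<^sup>+x. ennreal (exp (\<zeta> * u x)) * indicator {x \<in> space M. u x > s} x \<partial>M)
      \<le> (\<integral>\<^sup>+x. ennreal (exp (\<zeta> * b)) * indicator {x \<in> space M. u x > s} x
           + (\<Sum>m. ennreal (L m) * indicator (T m) x) \<partial>M)"
    by (intro nn_integral_mono pt)
  also have "\<dots> = ennreal (exp (\<zeta> * b)) * X + (\<Sum>m. ennreal (L m) * emeasure M (T m))"
    by (subst nn_integral_add, measurable)
      (simp_all add: nn_integral_suminf nn_integral_cmult_indicator X)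
  also have "\<dots> \<le> ennreal (exp (\<zeta> * b)) * X + (\<Sum>m. ennreal (L m) * (ennreal (B / 2 ^ m) * X))"
    using tail by (intro add_left_mono suminf_le mult_left_mono summableI) (auto simp: T_def)
  also have "(\<Sum>m. ennreal (L m) * (ennreal (B / 2 ^ m) * X))
      = (\<Sum>m. ennreal (B * exp (\<zeta> * (b + K)) * ?q ^ m)) * X"
    using \<open>0 \<le> B\<close>
    by (simp add: mult.assoc[symmetric] ennreal_suminf_multc ennreal_mult[symmetric] term_eq L)
  also have "(\<Sum>m. ennreal (B * exp (\<zeta> * (b + K)) * ?q ^ m)) = ennreal (B * exp (\<zeta> * (b + K)) * (1 / (1 - ?q)))"
    using sums \<open>0 \<le> B\<close> by (intro suminf_ennreal_eq) auto
  also have "ennreal (exp (\<zeta> * b)) * X + ennreal (B * exp (\<zeta> * (b + K)) * (1 / (1 - ?q))) * X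
      = ennreal (exp (\<zeta> * b) + B * exp (\<zeta> * (b + K)) / (1 - ?q)) * X"
    using \<open>0 \<le> B\<close> small by (simp add: ennreal_plus distrib_right)
  finally show ?thesis .
qed

section \<open>The truncated exponential series\<close>

text \<open>Removing the finitely many terms with \<open>j < p\<close> leaves a tail of the
  exponential series, which permits termwise comparison below.\<close>

lemma Phi_sums: "(\<lambda>j. if real j < p then 0 else t ^ j / fact j) sums Phi p t"
proof -
  have "{j. real j < p} \<subseteq> {..nat \<lceil>p\<rceil>}" by (auto intro: order_trans) linarith
  then have fin: "finite {j. real j < p}" by (rule finite_subset) simp
  have "(\<lambda>j. t ^ j / fact j) sums exp t"
    using exp_converges[of t] by (simp add: divide_inverse mult.commute)
  from sums_diff[OF this sums_If_finite[OF fin, of "\<lambda>j. t ^ j / fact j"]]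
  show ?thesis unfolding Phi_def by (rule back_subst[of "\<lambda>g. g sums _"]) auto
qed

lemma Phi_le_exp:
  assumes "0 \<le> t"
  shows "Phi p t \<le> exp t"
  unfolding Phi_def using assms by (simp add: sum_nonneg)

text \<open>Only powers with \<open>j \<ge> p\<close> survive, and for these
  \<open>u ^ j \<le> u powr p\<close> on the unit interval. The remaining coefficients sum to at
  most \<open>exp \<zeta>\<close>, uniformly in \<open>p\<close>.\<close>

lemma Phi_small_argument:
  assumes "0 \<le> u" "u \<le> 1" "0 < \<zeta>" "0 < p"
  shows "Phi p (\<zeta> * u) \<le> exp \<zeta> * u powr p"
proof -
  have le: "(if real j < p then 0 else (\<zeta> * u) ^ j / fact j) \<le> u powr p * (\<zeta> ^ j / fact j)" for j
  \<comment> \<open>At \<open>u = 0\<close> both sides vanish: \<open>0 powr p = 0\<close>, and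
    \<open>0 < p\<close> removes the constant term \<open>j = 0\<close>.\<close>
  proof (cases "real j < p \<or> u = 0")
    case False
    then have "u ^ j \<le> u powr p"
      using assms by (simp add: powr_realpow[symmetric] powr_mono')
    then have "\<zeta> ^ j * u ^ j \<le> \<zeta> ^ j * u powr p"
      using assms by (intro mult_left_mono) auto
    then show ?thesis using False by (simp add: power_mult_distrib divide_right_mono mult.commute)
  qed (use assms in \<open>auto simp: power_0_left\<close>)
  have "(\<lambda>j. u powr p * (\<zeta> ^ j / fact j)) sums (u powr p * exp \<zeta>)"
    using exp_converges[of \<zeta>] by (intro sums_mult) (simp add: divide_inverse mult.commute)
  from sums_le[OF le Phi_sums this] show ?thesis by (simp add: mult.commute)
qed

lemma Phi_2: "Phi 2 t = exp t - 1 - t"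
proof -
  have "{j. real j < 2} = {0, 1}" by auto
  then show ?thesis by (simp add: Phi_def)
qed

lemma Phi_2_mono:
  assumes "0 \<le> s" "s \<le> t"
  shows "Phi 2 s \<le> Phi 2 t"
  by (rule sums_le[OF _ Phi_sums Phi_sums]) (use assms in \<open>auto intro!: divide_right_mono power_mono\<close>)

lemma Phi_2_pos:
  assumes "t \<noteq> 0"
  shows "0 < Phi 2 t"
  using exp_ge_add_one_self[of t] assms exp_minus_greater[of "-t"] by (simp add: Phi_2)

section \<open>Oscillation on cells controlled by the Q norm\<close>

text \<open>Two subcubes at opposite corners of a cube of edge \<open>8 * h\<close> are at distance at least
  \<open>6 * sqrt n * h \<ge> 8 * h\<close>. There the kernel is bounded below uniformly in \<open>\<alpha> < 1\<close>,
  even when \<open>n + 2 * \<alpha>\<close> is very negative.\<close>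

lemma opposite_corners_norm:
  fixes x y b :: "real ^ 'n"
  assumes n: "CARD('n) \<ge> 2" and h: "0 < h"
    and x: "x \<in> cube b h" and y: "y \<in> cube (\<chi> i. b $ i + 7 * h) h"
  shows "8 * h \<le> norm (x - y)" "norm (x - y) \<le> real CARD('n) * (8 * h)"
proof -
  have xy: "6 * h \<le> y $ i - x $ i" "y $ i - x $ i \<le> 8 * h" for i
  proof -
    have "x $ i \<le> b $ i + h" "b $ i \<le> x $ i" "b $ i + 7 * h \<le> y $ i" "y $ i \<le> b $ i + 7 * h + h"
      using x y by (auto simp: cube_def mem_box_cart)
    then show "6 * h \<le> y $ i - x $ i" "y $ i - x $ i \<le> 8 * h" by linarith+
  qed
  have sq: "(6 * h)\<^sup>2 \<le> ((x - y) $ i)\<^sup>2" for i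
    using xy(1)[of i] h power_mono[of "6 * h" "y $ i - x $ i" 2] by (simp add: power2_commute)
  have "(8 * h)\<^sup>2 \<le> 2 * (6 * h)\<^sup>2" by (simp add: power2_eq_square)
  \<comment> \<open>Dimension at least two enters here: a single coordinate gives only the distance
    \<open>6 * h\<close>, while \<open>2 * 36 \<ge> 64\<close>.\<close>
  also have "\<dots> \<le> real CARD('n) * (6 * h)\<^sup>2" using n by (intro mult_right_mono) auto
  also have "\<dots> = (\<Sum>i\<in>(UNIV::'n set). (6 * h)\<^sup>2)" by simp
  also have "\<dots> \<le> (\<Sum>i\<in>UNIV. ((x - y) $ i)\<^sup>2)" by (intro sum_mono sq)
  also have "\<dots> = (norm (x - y))\<^sup>2"
    by (simp add: norm_vec_def L2_set_def sum_nonneg)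
  finally show "8 * h \<le> norm (x - y)" by (rule power2_le_imp_le) simp
  have "norm (x - y) \<le> (\<Sum>i\<in>UNIV. \<bar>(x - y) $ i\<bar>)" by (rule norm_le_l1_cart)
  also have "\<dots> \<le> (\<Sum>i\<in>(UNIV::'n set). 8 * h)"
    using xy h by (intro sum_mono) (smt (verit) vector_minus_component)
  finally show "norm (x - y) \<le> real CARD('n) * (8 * h)" by simp
qed

text \<open>For a nonnegative exponent the upper distance bound applies, and \<alpha> < 1 caps the
  resulting power of the dimension. For a negative exponent the power is decreasing and the lower
  bound \<open>8 * h\<close> loses nothing, so the constant does not grow as \<alpha> tends to minus
  infinity.\<close>

lemma opposite_corners_kernel:
  fixes x y b :: "real ^ 'n"
  assumes n: "CARD('n) \<ge> 2" and h: "0 < h" and \<alpha>: "\<alpha> < 1"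
    and x: "x \<in> cube b h" and y: "y \<in> cube (\<chi> i. b $ i + 7 * h) h"
  shows "norm (x - y) powr (real CARD('n) + 2 * \<alpha>)
      \<le> real CARD('n) ^ (CARD('n) + 2) * (8 * h) powr (real CARD('n) + 2 * \<alpha>)"
    (is "_ powr ?e \<le> _")
proof -
  note d = opposite_corners_norm[OF n h x y]
  have one: "1 \<le> real CARD('n) ^ (CARD('n) + 2)" by (rule one_le_power) simp
  show ?thesis
  proof (cases "0 \<le> ?e")
    case True
    have "norm (x - y) powr ?e \<le> (real CARD('n) * (8 * h)) powr ?e"
      using d True by (intro powr_mono2) auto
    also have "\<dots> = real CARD('n) powr ?e * (8 * h) powr ?e"
      using h by (simp add: powr_mult)
    also have "\<dots> \<le> real CARD('n) powr (real (CARD('n) + 2)) * (8 * h) powr ?e"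
      using \<alpha> by (intro mult_right_mono powr_mono) auto
    also have "\<dots> = real CARD('n) ^ (CARD('n) + 2) * (8 * h) powr ?e"
      by (subst powr_realpow) auto
    finally show ?thesis .
  next
    case False
    then have "norm (x - y) powr ?e \<le> (8 * h) powr ?e"
      using d h by (intro powr_mono2') auto
    also have "\<dots> \<le> real CARD('n) ^ (CARD('n) + 2) * (8 * h) powr ?e"
      using one mult_right_mono[OF one, of "(8 * h) powr ?e"] by simp
    finally show ?thesis .
  qed
qed

lemma Q_norm_double_integral:
  fixes f :: "real ^ 'n \<Rightarrow> complex"
  assumes f: "f \<in> Q_space \<alpha>" and l: "0 < l"
  shows "ennreal (l powr (2 * \<alpha> - real CARD('n))) *
          (\<integral>\<^sup>+y\<in>cube a l. (\<integral>\<^sup>+x\<in>cube a l.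
             ennreal ((cmod (f x - f y))\<^sup>2 / norm (x - y) powr (real CARD('n) + 2 * \<alpha>))
           \<partial>lebesgue) \<partial>lebesgue) \<le> ennreal ((Q_norm \<alpha> f)\<^sup>2)" (is "?X \<le> _")
proof -
  have fin: "Q_enorm \<alpha> f < \<infinity>" using f by (simp add: Q_space_def)
  have "ennreal_sqrt ?X \<le> Q_enorm \<alpha> f"
    unfolding Q_enorm_def by (rule SUP_upper2[of "(a, l)"]) (use l in auto)
  also have Q: "Q_enorm \<alpha> f = ennreal (Q_norm \<alpha> f)" using fin by (simp add: Q_norm_def)
  finally have le: "ennreal_sqrt ?X \<le> ennreal (Q_norm \<alpha> f)" .
  \<comment> \<open>Excludes the value \<infinity>, which \<open>enn2real\<close> would turn into
    \<open>0\<close>.\<close>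
  then have X: "?X \<noteq> \<infinity>" by (auto simp: ennreal_sqrt_def top_unique)
  have "sqrt (enn2real ?X) \<le> Q_norm \<alpha> f"
    using le X by (simp add: ennreal_sqrt_def Q_norm_def)
  then have "enn2real ?X \<le> (Q_norm \<alpha> f)\<^sup>2" by (rule sqrt_le_D)
  then have "ennreal (enn2real ?X) \<le> ennreal ((Q_norm \<alpha> f)\<^sup>2)" by (rule ennreal_leI)
  moreover have "ennreal (enn2real ?X) = ?X" using X by (intro ennreal_enn2real) (simp add: less_top)
  ultimately show ?thesis by simp
qed

text \<open>The power of \<open>n\<close> pays for the kernel, \<open>8 ^ (2 * n)\<close> for
  passing from a cube of edge \<open>8 * h\<close> to two subcubes of edge \<open>h\<close>, and the
  factor \<open>2\<close> makes the contradiction in the next proof strict.\<close>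

definition osc_const :: "nat \<Rightarrow> real" where
  "osc_const n = 2 * 8 ^ (2 * n) * real n ^ (n + 2)"

text \<open>A suitable \<open>z\<close> is a value \<open>f y\<close> with \<open>y\<close> in the
  opposite corner. If every such \<open>y\<close> failed, integrating over that corner would push
  the normalised double integral over the cube of edge \<open>8 * h\<close> to at least twice the
  squared norm.\<close>

lemma cube_oscillation_le_Q_norm:
  fixes f :: "real ^ 'n \<Rightarrow> complex"
  assumes n: "CARD('n) \<ge> 2" and h: "0 < h" and \<alpha>: "\<alpha> < 1"
    and f: "f \<in> Q_space \<alpha>" and q0: "Q_norm \<alpha> f \<noteq> 0"
  obtains z where "(\<integral>\<^sup>+x\<in>cube b h. ennreal ((cmod (f x - z))\<^sup>2) \<partial>lebesgue)
    \<le> ennreal (osc_const CARD('n) * (Q_norm \<alpha> f)\<^sup>2 * h ^ CARD('n))"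
proof (rule ccontr)
  define q where "q = Q_norm \<alpha> f"
  define N where "N = CARD('n)"
  define B where "B = osc_const N * q\<^sup>2 * h ^ N"
  assume "\<not> thesis"
  then have big: "ennreal B < (\<integral>\<^sup>+x\<in>cube b h. ennreal ((cmod (f x - z))\<^sup>2) \<partial>lebesgue)" for z
    using that unfolding B_def q_def N_def by (meson not_less)
  have q: "q > 0" using q0 by (simp add: q_def Q_norm_def less_le)
  have N: "N > 0" using n by (simp add: N_def)
  have B: "B > 0" using q h N by (simp add: B_def osc_const_def)
  define e where "e = real N + 2 * \<alpha>"
  define w where "w = 1 / (real N ^ (N + 2) * (8 * h) powr e)"
  have w: "w > 0" using h N by (simp add: w_def)
  have fm [measurable]: "f \<in> borel_measurable lebesgue" using f by (simp add: Q_space_def)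
  have cube_meas [measurable]: "cube a l \<in> sets lebesgue" for a :: "real ^ 'n" and l
    by (simp add: cube_def)
  define J' where "J' = cube (\<chi> i. b $ i + 7 * h) h"
  have sub: "cube b h \<subseteq> cube b (8 * h)" "J' \<subseteq> cube b (8 * h)"
  proof -
    show "cube b h \<subseteq> cube b (8 * h)"
      using h by (auto simp: cube_def mem_box_cart) (smt (verit))
    show "J' \<subseteq> cube b (8 * h)"
    proof
      fix y assume "y \<in> J'"
      then have "b $ i + 7 * h \<le> y $ i \<and> y $ i \<le> b $ i + 7 * h + h" for i
        by (auto simp: J'_def cube_def mem_box_cart)
      then have "b $ i \<le> y $ i \<and> y $ i \<le> b $ i + 8 * h" for i
        using h by (smt (verit))
      then show "y \<in> cube b (8 * h)" by (auto simp: cube_def mem_box_cart)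
    qed
  qed
  let ?F = "\<lambda>y. \<integral>\<^sup>+x\<in>cube b (8 * h). ennreal ((cmod (f x - f y))\<^sup>2 / norm (x - y) powr e) \<partial>lebesgue"
  have inner: "ennreal (w * B) \<le> ?F y" if y: "y \<in> J'" for y
  proof -
    have "ennreal (w * B) \<le> ennreal w * (\<integral>\<^sup>+x\<in>cube b h. ennreal ((cmod (f x - f y))\<^sup>2) \<partial>lebesgue)"
      using big[of "f y"] w B by (simp add: ennreal_mult mult_left_mono less_imp_le)
    also have "\<dots> = (\<integral>\<^sup>+x. ennreal w * (ennreal ((cmod (f x - f y))\<^sup>2) * indicator (cube b h) x) \<partial>lebesgue)"
      by (rule nn_integral_cmult[symmetric]) measurable
    also have "\<dots> \<le> ?F y"
    proof (intro nn_integral_mono)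
      fix x :: "real ^ 'n"
      show "ennreal w * (ennreal ((cmod (f x - f y))\<^sup>2) * indicator (cube b h) x)
        \<le> ennreal ((cmod (f x - f y))\<^sup>2 / norm (x - y) powr e) * indicator (cube b (8 * h)) x"
      proof (cases "x \<in> cube b h")
        case True
        have k: "norm (x - y) powr e \<le> real N ^ (N + 2) * (8 * h) powr e"
          unfolding e_def N_def
          by (rule opposite_corners_kernel[OF n h \<alpha> True y[unfolded J'_def]])
        have "norm (x - y) > 0" using opposite_corners_norm(1)[OF n h True y[unfolded J'_def]] h by linarith
        then have "norm (x - y) powr e > 0" by simp
        moreover have "real N ^ (N + 2) * (8 * h) powr e > 0" using h N by simp
        ultimately have "w * (cmod (f x - f y))\<^sup>2 \<le> (cmod (f x - f y))\<^sup>2 / norm (x - y) powr e"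
          using divide_left_mono[OF k, of "(cmod (f x - f y))\<^sup>2"] by (simp add: w_def)
        then have "ennreal w * ennreal ((cmod (f x - f y))\<^sup>2)
            \<le> ennreal ((cmod (f x - f y))\<^sup>2 / norm (x - y) powr e)"
          using w by (simp add: ennreal_mult[symmetric] ennreal_leI)
        then show ?thesis using True sub by (auto simp: indicator_def)
      qed simp
    qed
    finally show ?thesis .
  qed
  have "ennreal (w * B) * ennreal (h ^ N) = (\<integral>\<^sup>+y. ennreal (w * B) * indicator J' y \<partial>lebesgue)"
    unfolding J'_def N_def using h
    by (subst nn_integral_cmult_indicator) (auto simp: emeasure_cube)
  also have "\<dots> \<le> (\<integral>\<^sup>+y\<in>cube b (8 * h). ?F y \<partial>lebesgue)"
    using inner sub by (intro nn_integral_mono) (auto simp: indicator_def)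
  finally have "ennreal ((8 * h) powr (2 * \<alpha> - real N)) * (ennreal (w * B) * ennreal (h ^ N))
      \<le> ennreal ((8 * h) powr (2 * \<alpha> - real N)) * (\<integral>\<^sup>+y\<in>cube b (8 * h). ?F y \<partial>lebesgue)"
    by (intro mult_left_mono) auto
  also have "\<dots> \<le> ennreal (q\<^sup>2)"
    using Q_norm_double_integral[OF f, of "8 * h" b] h by (simp add: e_def N_def q_def)
  finally have "ennreal ((8 * h) powr (2 * \<alpha> - real N) * (w * B * h ^ N)) \<le> ennreal (q\<^sup>2)"
    using w B h by (simp add: ennreal_mult)
  then have le: "(8 * h) powr (2 * \<alpha> - real N) * (w * B * h ^ N) \<le> q\<^sup>2" by simp
  \<comment> \<open>Splitting off \<open>(8 * h) powr e\<close> cancels the same factor in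
    \<open>w\<close>; the dependence on \<alpha> disappears.\<close>
  have "(8 * h) powr (2 * \<alpha> - real N) = (8 * h) powr e / (8 * h) ^ (2 * N)"
  proof -
    have "2 * \<alpha> - real N = e - real (2 * N)" by (simp add: e_def)
    then have "(8 * h) powr (2 * \<alpha> - real N) = (8 * h) powr e / (8 * h) powr real (2 * N)"
      by (simp only: powr_diff)
    then show ?thesis using h by (subst (asm) powr_realpow) auto
  qed
  moreover have "(8 * h) powr e > 0" using h by simp
  ultimately have "(8 * h) powr (2 * \<alpha> - real N) * (w * B * h ^ N) = 2 * q\<^sup>2"
    using h N unfolding w_def B_def osc_const_def
    by (simp add: field_simps power_mult_distrib power_mult power2_eq_square)
  then show False using le q by simp
qed

lemma chebyshev_square:
  fixes f :: "'a \<Rightarrow> complex"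
  assumes [measurable]: "f \<in> borel_measurable M" "A \<in> sets M" and "0 < d" "0 \<le> v"
    and le: "(\<integral>\<^sup>+x\<in>A. ennreal ((cmod (f x - z))\<^sup>2) \<partial>M) \<le> ennreal v"
  shows "emeasure M {x \<in> A. cmod (f x - z) > d} \<le> ennreal (v / d\<^sup>2)"
proof -
  have "{x \<in> space M. cmod (f x - z) > d} \<inter> A \<in> sets M" by measurable
  moreover have "{x \<in> A. cmod (f x - z) > d} = {x \<in> space M. cmod (f x - z) > d} \<inter> A"
    using sets.sets_into_space[OF assms(2)] by auto
  ultimately have meas [measurable]: "{x \<in> A. cmod (f x - z) > d} \<in> sets M" by simp
  have "ennreal (d\<^sup>2) * emeasure M {x \<in> A. cmod (f x - z) > d}
      = (\<integral>\<^sup>+x. ennreal (d\<^sup>2) * indicator {x \<in> A. cmod (f x - z) > d} x \<partial>M)"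
    by (simp add: nn_integral_cmult_indicator)
  also have "\<dots> \<le> (\<integral>\<^sup>+x\<in>A. ennreal ((cmod (f x - z))\<^sup>2) \<partial>M)"
    using \<open>0 < d\<close> by (intro nn_integral_mono) (auto simp: indicator_def intro!: ennreal_leI power_mono)
  finally have le': "ennreal (d\<^sup>2) * emeasure M {x \<in> A. cmod (f x - z) > d} \<le> ennreal v"
    using le by (rule order_trans)
  have "emeasure M {x \<in> A. cmod (f x - z) > d}
      = ennreal (1 / d\<^sup>2) * (ennreal (d\<^sup>2) * emeasure M {x \<in> A. cmod (f x - z) > d})"
    using \<open>0 < d\<close> by (simp add: mult.assoc[symmetric] ennreal_mult[symmetric])
  also have "\<dots> \<le> ennreal (1 / d\<^sup>2) * ennreal v" by (intro mult_left_mono le') simp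
  also have "\<dots> = ennreal (v / d\<^sup>2)" using \<open>0 \<le> v\<close> \<open>0 < d\<close> by (simp add: ennreal_mult[symmetric])
  finally show ?thesis .
qed

text \<open>The radius at which Chebyshev's inequality gives exactly the proportion
  \<open>1 / 2 ^ (n + 2)\<close>, that is \<open>\<theta> / 2\<close>, required by the
  John-Nirenberg lemmas.\<close>

definition osc_radius :: "nat \<Rightarrow> real" where
  "osc_radius n = sqrt (osc_const n * 2 ^ (n + 2))"

lemma normalized_Q_oscillation:
  fixes f :: "real ^ 'n \<Rightarrow> complex"
  assumes n: "CARD('n) \<ge> 2" and \<alpha>: "\<alpha> < 1"
    and f: "f \<in> Q_space \<alpha>" and q0: "Q_norm \<alpha> f \<noteq> 0"
  obtains c :: "(real ^ 'n) set \<Rightarrow> complex" where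
    "\<And>k x. emeasure lebesgue {y \<in> dyadic_cell k x. cmod (f y / Q_norm \<alpha> f - c (dyadic_cell k x)) > osc_radius CARD('n)}
      \<le> ennreal (1 / 2 ^ (CARD('n) + 1) / 2) * emeasure lebesgue (dyadic_cell k x)"
proof -
  define q where "q = Q_norm \<alpha> f"
  define R where "R = osc_radius CARD('n)"
  have q: "q > 0" using q0 by (simp add: q_def Q_norm_def less_le)
  have oc: "osc_const CARD('n) > 0" by (simp add: osc_const_def)
  then have R: "R > 0" "R\<^sup>2 = osc_const CARD('n) * 2 ^ (CARD('n) + 2)"
    by (simp_all add: R_def osc_radius_def)
  have fm: "f \<in> borel_measurable lebesgue" using f by (simp add: Q_space_def)
  let ?bd = "\<lambda>I z. emeasure lebesgue {y \<in> I. cmod (f y / q - z) > R}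
      \<le> ennreal (1 / 2 ^ (CARD('n) + 1) / 2) * emeasure lebesgue I"
  have "\<exists>z. ?bd (dyadic_cell k x) z" for k x
  proof -
    define h where "h = (2::real) powi k"
    have h: "h > 0" by (simp add: h_def)
    obtain a where a: "dyadic_cell k x \<subseteq> cube a h"
      unfolding h_def by (rule dyadic_cell_cube)
    obtain z where z: "(\<integral>\<^sup>+x\<in>cube a h. ennreal ((cmod (f x - z))\<^sup>2) \<partial>lebesgue)
        \<le> ennreal (osc_const CARD('n) * q\<^sup>2 * h ^ CARD('n))"
      unfolding q_def by (rule cube_oscillation_le_Q_norm[OF n h \<alpha> f q0])
    have "cmod (f y / q - z / q) > R \<longleftrightarrow> cmod (f y - z) > R * q" for y
      using q by (simp add: diff_divide_distrib[symmetric] norm_divide field_simps)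
    then have "emeasure lebesgue {y \<in> dyadic_cell k x. cmod (f y / q - z / q) > R}
        = emeasure lebesgue {y \<in> dyadic_cell k x. cmod (f y - z) > R * q}" by simp
    also have "\<dots> \<le> ennreal (osc_const CARD('n) * q\<^sup>2 * h ^ CARD('n) / (R * q)\<^sup>2)"
    proof (rule chebyshev_square[OF fm])
      show "(\<integral>\<^sup>+x\<in>dyadic_cell k x. ennreal ((cmod (f x - z))\<^sup>2) \<partial>lebesgue)
          \<le> ennreal (osc_const CARD('n) * q\<^sup>2 * h ^ CARD('n))"
        using a by (intro order_trans[OF _ z] nn_integral_mono) (auto simp: indicator_def)
    qed (use R q oc h in auto)
    also have "osc_const CARD('n) * q\<^sup>2 * h ^ CARD('n) / (R * q)\<^sup>2 = 1 / 2 ^ (CARD('n) + 1) / 2 * h ^ CARD('n)"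
      using q oc by (simp add: power_mult_distrib R(2))
    also have "ennreal \<dots> = ennreal (1 / 2 ^ (CARD('n) + 1) / 2) * emeasure lebesgue (dyadic_cell k x)"
      using h by (subst ennreal_mult) (simp_all add: emeasure_dyadic_cell h_def)
    finally show ?thesis by blast
  qed
  \<comment> \<open>The choice runs over cells as sets, since many points name the same cell and
    \<open>c\<close> must give it one centre.\<close>
  then have "\<forall>I \<in> range (\<lambda>(k, x). dyadic_cell k x). \<exists>z. ?bd I z" by auto
  then obtain c where "\<forall>I \<in> range (\<lambda>(k, x). dyadic_cell k x). ?bd I (c I)"
    by (rule bchoice[THEN exE])
  then show ?thesis by (intro that[of c]) (auto simp: q_def R_def)
qed

section \<open>Exponential integrability and tail estimates\<close>

lemma Lp_norm_normalized:
  fixes f :: "real ^ 'n \<Rightarrow> complex"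
  assumes f: "f \<in> Lp_space p" and p: "0 < p" and q: "0 < q"
  shows "(\<integral>\<^sup>+x. ennreal ((cmod (f x) / q) powr p) \<partial>lebesgue) = ennreal ((Lp_norm p f / q) powr p)"
proof -
  have int: "integrable lebesgue (\<lambda>x. cmod (f x) powr p)" using f by (simp add: Lp_space_def)
  have nonneg: "0 \<le> (LINT x|lebesgue. cmod (f x) powr p)" by (intro Bochner_Integration.integral_nonneg) simp
  have eq: "(cmod (f x) / q) powr p = cmod (f x) powr p / q powr p" for x
    using q by (simp add: powr_divide)
  have "(\<integral>\<^sup>+x. ennreal ((cmod (f x) / q) powr p) \<partial>lebesgue)
      = ennreal (LINT x|lebesgue. cmod (f x) powr p / q powr p)"
    unfolding eq using int by (intro nn_integral_eq_integral) auto
  also have "\<dots> = ennreal ((LINT x|lebesgue. cmod (f x) powr p) / q powr p)" by simp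
  also have "(LINT x|lebesgue. cmod (f x) powr p) = Lp_norm p f powr p"
    unfolding Lp_norm_def using p nonneg by (simp add: powr_powr)
  also have "\<dots> / q powr p = (Lp_norm p f / q) powr p"
    using q by (simp add: powr_divide Lp_norm_def)
  finally show ?thesis .
qed

text \<open>The first \<open>exp \<zeta>\<close> covers the values \<open>|f| \<le> 1\<close> after
  normalisation. The rest is the constant of \<open>exp_integral_of_geometric_tails\<close> with
  \<open>b = 1 + R\<close>, \<open>K = 2 * R\<close>, \<open>B = 2 ^ (n + 1)\<close> for
  \<open>R = osc_radius n\<close>.\<close>

definition exp_const :: "nat \<Rightarrow> real \<Rightarrow> real" where
  "exp_const n \<zeta> = exp \<zeta> + (exp (\<zeta> * (1 + osc_radius n)) +
     2 ^ (n + 1) * exp (\<zeta> * (1 + osc_radius n + 2 * osc_radius n)) / (1 - exp (\<zeta> * (2 * osc_radius n)) / 2))"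

text \<open>The integral is split at normalised height \<open>1\<close>. Below it, the power
  \<open>p\<close> controls \<open>Phi p\<close>; above it, the exponential does, and its integral
  is a multiple of the measure of that level set. Neither constant involves \<open>p\<close> or
  \<alpha>.\<close>

lemma Phi_integral_bound:
  fixes f :: "real ^ 'n \<Rightarrow> complex"
  assumes n: "CARD('n) \<ge> 2" and \<alpha>: "\<alpha> < 1" and p: "1 < p"
    and f: "f \<in> Lp_space p \<inter> Q_space \<alpha>" and q0: "Q_norm \<alpha> f \<noteq> 0"
    and \<zeta>: "0 < \<zeta>" "\<zeta> < ln 2 / (2 * osc_radius CARD('n))"
  shows "(\<integral>\<^sup>+x. ennreal (Phi p (\<zeta> * (cmod (f x) / Q_norm \<alpha> f))) \<partial>lebesgue)
    \<le> ennreal (exp_const CARD('n) \<zeta> * (Lp_norm p f / Q_norm \<alpha> f) powr p)"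
proof -
  define q where "q = Q_norm \<alpha> f"
  define R where "R = osc_radius CARD('n)"
  define u where "u x = cmod (f x) / q" for x
  define X where "X = emeasure lebesgue {x. u x > 1}"
  define M where "M = (\<integral>\<^sup>+x. ennreal (u x powr p) \<partial>lebesgue)"
  have q: "q > 0" using q0 by (simp add: q_def Q_norm_def less_le)
  have R: "R > 0" by (simp add: R_def osc_radius_def osc_const_def)
  have fm [measurable]: "f \<in> borel_measurable lebesgue" using f by (simp add: Q_space_def)
  have um [measurable]: "u \<in> borel_measurable lebesgue" unfolding u_def by measurable
  have upos: "u x \<ge> 0" for x using q by (simp add: u_def)
  have M: "M = ennreal ((Lp_norm p f / q) powr p)"
    unfolding M_def u_def using f p q by (intro Lp_norm_normalized) auto
  have "{x \<in> space lebesgue. u x > 1} \<in> sets lebesgue" by measurable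
  then have Um [measurable]: "{x. u x > 1} \<in> sets lebesgue" by simp
  \<comment> \<open>Markov's inequality at height \<open>1\<close>, where the constant is
    \<open>1\<close> for every \<open>p\<close>.\<close>
  have XM: "X \<le> M"
  proof -
    have "X = (\<integral>\<^sup>+x. indicator {x. u x > 1} x \<partial>lebesgue)" by (simp add: X_def)
    also have "\<dots> \<le> M" unfolding M_def
    proof (intro nn_integral_mono)
      fix x
      show "indicator {x. u x > 1} x \<le> ennreal (u x powr p)"
        using p ge_one_powr_ge_zero[of "u x" p] ennreal_leI[of 1 "u x powr p"] by (cases "u x > 1") auto
    qed
    finally show ?thesis .
  qed
  obtain c :: "(real ^ 'n) set \<Rightarrow> complex" where
    c: "\<And>k x. emeasure lebesgue {y \<in> dyadic_cell k x. cmod (f y / q - c (dyadic_cell k x)) > R}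
      \<le> ennreal (1 / 2 ^ (CARD('n) + 1) / 2) * emeasure lebesgue (dyadic_cell k x)"
    using normalized_Q_oscillation[OF n \<alpha> _ q0] f unfolding q_def R_def by blast
  have nu: "cmod (f y / q) = u y" for y using q by (simp add: u_def norm_divide)
  \<comment> \<open>Membership in \<open>Lp_space p\<close> supplies the finite level set from which
    the global decay starts.\<close>
  have "X < \<infinity>" using XM M by (simp add: le_less_trans)
  then have tail: "emeasure lebesgue {y. u y > (1 + R) + (2 * R) * real m} \<le> ennreal (2 ^ (CARD('n) + 1) / 2 ^ m) * X" for m
    using global_john_nirenberg[of "\<lambda>y. f y / q" R c 1 m, unfolded nu, OF _ c] R
    by (simp add: X_def)
  have "exp (\<zeta> * (2 * R)) < 2"
  proof -
    have "\<zeta> * (2 * R) < ln 2" using \<zeta>(2) R unfolding R_def[symmetric] by (simp add: pos_less_divide_eq)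
    then have "exp (\<zeta> * (2 * R)) < exp (ln 2)" by (simp only: exp_less_cancel_iff)
    then show ?thesis by simp
  qed
  define K where "K = exp (\<zeta> * (1 + R)) + 2 ^ (CARD('n) + 1) * exp (\<zeta> * (1 + R + 2 * R)) / (1 - exp (\<zeta> * (2 * R)) / 2)"
  have K: "0 \<le> K" using \<open>exp (\<zeta> * (2 * R)) < 2\<close> by (simp add: K_def)
  have big: "(\<integral>\<^sup>+x. ennreal (exp (\<zeta> * u x)) * indicator {x. u x > 1} x \<partial>lebesgue) \<le> ennreal K * X"
    using exp_integral_of_geometric_tails[of u lebesgue "1 + R" "2 * R" "2 ^ (CARD('n) + 1)" X \<zeta> 1]
      tail R \<zeta>(1) \<open>exp (\<zeta> * (2 * R)) < 2\<close>
    by (simp add: X_def K_def)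
  have "(\<integral>\<^sup>+x. ennreal (Phi p (\<zeta> * u x)) \<partial>lebesgue)
      \<le> (\<integral>\<^sup>+x. ennreal (exp \<zeta>) * ennreal (u x powr p) + ennreal (exp (\<zeta> * u x)) * indicator {x. u x > 1} x \<partial>lebesgue)"
  proof (intro nn_integral_mono)
    fix x
    show "ennreal (Phi p (\<zeta> * u x)) \<le> ennreal (exp \<zeta>) * ennreal (u x powr p)
        + ennreal (exp (\<zeta> * u x)) * indicator {x. u x > 1} x"
    proof (cases "u x > 1")
      case True
      then show ?thesis
        using Phi_le_exp[of "\<zeta> * u x" p] upos[of x] \<zeta>(1) by (intro add_increasing) (auto intro!: ennreal_leI)
    next
      case False
      then show ?thesis
        using Phi_small_argument[of "u x" \<zeta> p] upos[of x] \<zeta>(1) p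
        by (simp add: ennreal_mult[symmetric] ennreal_leI)
    qed
  qed
  also have "\<dots> = ennreal (exp \<zeta>) * M + (\<integral>\<^sup>+x. ennreal (exp (\<zeta> * u x)) * indicator {x. u x > 1} x \<partial>lebesgue)"
    unfolding M_def by (subst nn_integral_add; measurable?) (simp add: nn_integral_cmult)
  also have "\<dots> \<le> ennreal (exp \<zeta>) * M + ennreal K * M"
    using XM by (intro add_left_mono order_trans[OF big] mult_left_mono) auto
  also have "\<dots> = ennreal (exp \<zeta> + K) * M"
    using K by (simp add: ennreal_plus distrib_right)
  also have "\<dots> = ennreal ((exp \<zeta> + K) * (Lp_norm p f / q) powr p)"
    unfolding M using K by (intro ennreal_mult[symmetric]) auto
  also have "exp \<zeta> + K = exp_const CARD('n) \<zeta>"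
    by (simp only: exp_const_def K_def R_def)
  finally show ?thesis by (simp add: u_def q_def)
qed

text \<open>The second claim is the case \<open>p = 2\<close> of the first at one fixed
  \<open>\<zeta>\<close>, turned into a weak bound by Chebyshev's inequality: \<open>Phi 2\<close>
  is increasing on nonnegative arguments and is the denominator there.\<close>

theorem theorem1p5:
  assumes "CARD('n::finite) \<ge> 2"
  shows "(\<exists>\<gamma>>0. \<forall>\<zeta>. 0 < \<zeta> \<and> \<zeta> < \<gamma> \<longrightarrow>
            (\<exists>C::real. \<forall>p \<alpha>. \<forall>f :: real ^ 'n \<Rightarrow> complex.
               1 < p \<and> \<alpha> < 1 \<and> f \<in> Lp_space p \<inter> Q_space \<alpha> \<and> Q_norm \<alpha> f \<noteq> 0 \<longrightarrow>
               (\<integral>\<^sup>+x. ennreal (Phi p (\<zeta> * (cmod (f x) / Q_norm \<alpha> f))) \<partial>lebesgue)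
                 \<le> ennreal (C * (Lp_norm p f / Q_norm \<alpha> f) powr p)))
       \<and> (\<exists>\<gamma>>0. \<exists>C>0.
            (\<forall>t \<alpha>. \<forall>f :: real ^ 'n \<Rightarrow> complex.
               0 < t \<and> \<alpha> < 1 \<and> f \<in> Lp_space 2 \<inter> Q_space \<alpha> \<and> Q_norm \<alpha> f \<noteq> 0 \<longrightarrow>
               emeasure lebesgue {x. cmod (f x) > t}
                 \<le> ennreal (C * ((Lp_norm 2 f)\<^sup>2 / (Q_norm \<alpha> f)\<^sup>2) *
                     (1 / (exp (t * \<gamma> / Q_norm \<alpha> f) - 1 - t * \<gamma> / Q_norm \<alpha> f))))
          \<and> (\<forall>t \<alpha>. \<forall>f :: real ^ 'n \<Rightarrow> complex.
               \<alpha> < 1 \<and> f \<in> Lp_space 2 \<inter> Q_space \<alpha> \<and> Q_norm \<alpha> f \<noteq> 0 \<and> t > Q_norm \<alpha> f \<longrightarrow>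
               emeasure lebesgue {x. cmod (f x) > t}
                 \<le> ennreal (C * ((Lp_norm 2 f)\<^sup>2 / (Q_norm \<alpha> f)\<^sup>2) *
                     exp (- (t * \<gamma> / Q_norm \<alpha> f)))))"
proof -
  define \<gamma> where "\<gamma> = ln 2 / (2 * osc_radius CARD('n))"
  have R: "osc_radius CARD('n) > 0" by (simp add: osc_radius_def osc_const_def)
  then have \<gamma>: "\<gamma> > 0" by (simp add: \<gamma>_def)
  \<comment> \<open>This is the exponent constant of the second claim; it has to lie strictly below
    the threshold of the first.\<close>
  define g where "g = \<gamma> / 2"
  define C0 where "C0 = max 1 (exp_const CARD('n) g)"
  \<comment> \<open>The ratio \<open>Phi 2 s / exp s = 1 - (1 + s) * exp (- s)\<close> increases for
    \<open>s \<ge> 0\<close>, so its value at \<open>g\<close> bounds it from below for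
    \<open>s \<ge> g\<close>.\<close>
  define c where "c = Phi 2 g / exp g"
  have g: "0 < g" "g < \<gamma>" using \<gamma> by (simp_all add: g_def)
  have c: "c > 0" using Phi_2_pos[of g] g by (simp add: c_def)
  define C where "C = max C0 (C0 / c)"
  have C: "C > 0" "C0 \<le> C" "C0 / c \<le> C" by (simp_all add: C_def C0_def)
  have weak: "emeasure lebesgue {x. cmod (f x) > t}
      \<le> ennreal (C0 * ((Lp_norm 2 f)\<^sup>2 / (Q_norm \<alpha> f)\<^sup>2) * (1 / Phi 2 (t * g / Q_norm \<alpha> f)))"
    if H: "0 < t" "\<alpha> < 1" "f \<in> Lp_space 2 \<inter> Q_space \<alpha>" "Q_norm \<alpha> f \<noteq> 0"
    for t \<alpha> and f :: "real ^ 'n \<Rightarrow> complex"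
  proof -
    define q where "q = Q_norm \<alpha> f"
    define P where "P = Phi 2 (t * g / q)"
    define A where "A = (Lp_norm 2 f)\<^sup>2 / q\<^sup>2"
    have q: "q > 0" using H by (simp add: q_def Q_norm_def less_le)
    have P: "P > 0" unfolding P_def using H q g by (intro Phi_2_pos) simp
    have A: "A \<ge> 0" "(Lp_norm 2 f / q) powr 2 = A"
      using q by (simp_all add: A_def power_divide powr_numeral Lp_norm_def)
    have [measurable]: "f \<in> borel_measurable lebesgue" using H by (simp add: Q_space_def)
    have "{x \<in> space lebesgue. cmod (f x) > t} \<in> sets lebesgue" by measurable
    then have S: "{x. cmod (f x) > t} \<in> sets lebesgue" by simp
    have "ennreal P * emeasure lebesgue {x. cmod (f x) > t}
        = (\<integral>\<^sup>+x. ennreal P * indicator {x. cmod (f x) > t} x \<partial>lebesgue)"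
      using S by (simp add: nn_integral_cmult_indicator)
    also have "\<dots> \<le> (\<integral>\<^sup>+x. ennreal (Phi 2 (g * (cmod (f x) / q))) \<partial>lebesgue)"
    proof (intro nn_integral_mono)
      fix x
      show "ennreal P * indicator {x. cmod (f x) > t} x \<le> ennreal (Phi 2 (g * (cmod (f x) / q)))"
      proof (cases "cmod (f x) > t")
        case True
        then have "t * g / q \<le> g * (cmod (f x) / q)" using g q by (simp add: divide_right_mono)
        then show ?thesis
          unfolding P_def using H g q True by (simp add: ennreal_leI Phi_2_mono)
      qed simp
    qed
    also have "\<dots> \<le> ennreal (exp_const CARD('n) g * (Lp_norm 2 f / q) powr 2)"
      unfolding q_def by (rule Phi_integral_bound[OF assms H(2) _ H(3,4)]) (use g in \<open>simp_all add: \<gamma>_def\<close>)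
    also have "\<dots> \<le> ennreal (C0 * A)"
      unfolding A(2) using A(1) by (intro ennreal_leI mult_right_mono) (simp_all add: C0_def)
    finally have le: "ennreal P * emeasure lebesgue {x. cmod (f x) > t} \<le> ennreal (C0 * A)" .
    have "emeasure lebesgue {x. cmod (f x) > t} = ennreal (1 / P) * (ennreal P * emeasure lebesgue {x. cmod (f x) > t})"
      using P by (simp add: mult.assoc[symmetric] ennreal_mult[symmetric])
    also have "\<dots> \<le> ennreal (1 / P) * ennreal (C0 * A)" by (intro mult_left_mono le) simp
    also have "\<dots> = ennreal (C0 * A * (1 / P))"
      using P A by (simp add: C0_def ennreal_mult[symmetric])
    finally show ?thesis by (simp only: A_def P_def q_def)
  qed
  have "emeasure lebesgue {x. cmod (f x) > t}
      \<le> ennreal (C * ((Lp_norm 2 f)\<^sup>2 / (Q_norm \<alpha> f)\<^sup>2) *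
                     (1 / (exp (t * g / Q_norm \<alpha> f) - 1 - t * g / Q_norm \<alpha> f)))"
    if H: "0 < t" "\<alpha> < 1" "f \<in> Lp_space 2 \<inter> Q_space \<alpha>" "Q_norm \<alpha> f \<noteq> 0"
    for t \<alpha> and f :: "real ^ 'n \<Rightarrow> complex"
  proof -
    have "t * g / Q_norm \<alpha> f \<noteq> 0" using H g by simp
    from Phi_2_pos[OF this]
    show ?thesis unfolding Phi_2[symmetric]
      using C by (intro order_trans[OF weak[OF H]] ennreal_leI mult_right_mono) auto
  qed
  moreover have "emeasure lebesgue {x. cmod (f x) > t}
      \<le> ennreal (C * ((Lp_norm 2 f)\<^sup>2 / (Q_norm \<alpha> f)\<^sup>2) * exp (- (t * g / Q_norm \<alpha> f)))"
    if H: "\<alpha> < 1" "f \<in> Lp_space 2 \<inter> Q_space \<alpha>" "Q_norm \<alpha> f \<noteq> 0" "t > Q_norm \<alpha> f"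
    for t \<alpha> and f :: "real ^ 'n \<Rightarrow> complex"
  proof -
    define q where "q = Q_norm \<alpha> f"
    define s where "s = t * g / q"
    define A where "A = (Lp_norm 2 f)\<^sup>2 / q\<^sup>2"
    have q: "q > 0" using H by (simp add: q_def Q_norm_def less_le)
    then have "t > 0" using H by (simp add: q_def)
    \<comment> \<open>The restriction on \<open>t\<close> keeps \<open>s\<close> away from
      \<open>0\<close>, where \<open>Phi 2\<close> vanishes and no multiple of \<open>exp\<close>
      lies below it.\<close>
    have s: "s \<ge> g" using H q g by (simp add: s_def q_def[symmetric] field_simps)
    have "(1 + s) * exp g \<le> (1 + g) * exp s"
    proof -
      \<comment> \<open>The difference of the two sides is \<open>g * (s - g)\<close>; this replaces
        a derivative argument for the monotonicity of \<open>(1 + s) * exp (- s)\<close>.\<close>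
      have "1 + s \<le> (1 + g) * (1 + (s - g))"
        using s g by (simp add: algebra_simps mult_left_mono)
      also have "\<dots> \<le> (1 + g) * exp (s - g)"
        using g exp_ge_add_one_self[of "s - g"] by (intro mult_left_mono) auto
      finally show ?thesis by (simp add: exp_diff field_simps)
    qed
    then have "c * exp s \<le> Phi 2 s"
      by (simp add: c_def Phi_2 field_simps)
    then have "1 / Phi 2 s \<le> 1 / (c * exp s)"
      using c Phi_2_pos[of s] s g by (intro divide_left_mono) auto
    then have "C0 * (1 / Phi 2 s) \<le> C0 * (1 / (c * exp s))"
      by (intro mult_left_mono) (simp_all add: C0_def)
    also have "\<dots> = C0 / c * exp (- s)" by (simp add: exp_minus field_simps)
    also have "\<dots> \<le> C * exp (- s)" using C by (intro mult_right_mono) auto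
    finally have "A * (C0 * (1 / Phi 2 s)) \<le> A * (C * exp (- s))"
      by (intro mult_left_mono) (simp_all add: A_def)
    then have "C0 * A * (1 / Phi 2 s) \<le> C * A * exp (- s)" by (simp only: mult_ac)
    then show ?thesis
      using order_trans[OF weak[OF \<open>t > 0\<close> H(1-3)] ennreal_leI] by (simp only: A_def s_def q_def)
  qed
  ultimately have "\<exists>\<gamma>>0. \<exists>C>0.
      (\<forall>t \<alpha>. \<forall>f :: real ^ 'n \<Rightarrow> complex.
         0 < t \<and> \<alpha> < 1 \<and> f \<in> Lp_space 2 \<inter> Q_space \<alpha> \<and> Q_norm \<alpha> f \<noteq> 0 \<longrightarrow>
         emeasure lebesgue {x. cmod (f x) > t}
           \<le> ennreal (C * ((Lp_norm 2 f)\<^sup>2 / (Q_norm \<alpha> f)\<^sup>2) *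
               (1 / (exp (t * \<gamma> / Q_norm \<alpha> f) - 1 - t * \<gamma> / Q_norm \<alpha> f))))
    \<and> (\<forall>t \<alpha>. \<forall>f :: real ^ 'n \<Rightarrow> complex.
         \<alpha> < 1 \<and> f \<in> Lp_space 2 \<inter> Q_space \<alpha> \<and> Q_norm \<alpha> f \<noteq> 0 \<and> t > Q_norm \<alpha> f \<longrightarrow>
         emeasure lebesgue {x. cmod (f x) > t}
           \<le> ennreal (C * ((Lp_norm 2 f)\<^sup>2 / (Q_norm \<alpha> f)\<^sup>2) * exp (- (t * \<gamma> / Q_norm \<alpha> f))))"
    using g C by blast
  moreover have "\<exists>\<gamma>>0. \<forall>\<zeta>. 0 < \<zeta> \<and> \<zeta> < \<gamma> \<longrightarrow>
            (\<exists>C::real. \<forall>p \<alpha>. \<forall>f :: real ^ 'n \<Rightarrow> complex.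
               1 < p \<and> \<alpha> < 1 \<and> f \<in> Lp_space p \<inter> Q_space \<alpha> \<and> Q_norm \<alpha> f \<noteq> 0 \<longrightarrow>
               (\<integral>\<^sup>+x. ennreal (Phi p (\<zeta> * (cmod (f x) / Q_norm \<alpha> f))) \<partial>lebesgue)
                 \<le> ennreal (C * (Lp_norm p f / Q_norm \<alpha> f) powr p))"
    using \<gamma> Phi_integral_bound[OF assms] unfolding \<gamma>_def by blast
  ultimately show ?thesis by blast
qed

end
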